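(* Let $\beta$ be an algebraic integer of degree $n \ge 5$, let $\beta_{1}, \ldots, \beta_{n}$ be its conjugates and suppose that $\mathrm{Gal}(\mathbb{Q}(\beta_{1}, \ldots, \beta_{n})/ \mathbb{Q}) = \mathfrak{A}_{n}$. Consider $\alpha=a_{1} \beta_{1}+\cdots+a_n \beta_n$ where $a_{1},\ldots,a_{n} \in \mathbb{Z}$. Then: (1) $\alpha$ is a generator of $\mathbb{Q}(\beta_{1}, \ldots, \beta_{n})/ \mathbb{Q}$ (i.e. $\mathbb{Q}(\alpha)=\mathbb{Q}(\beta_1,\dots,\beta_n)$) if and only if there is at most one pair of indices $i<j$ with $a_{i}=a_{j}$, i.e. $|\{a_1,\dots,a_n\}|\ge n-1$. (2) If $\alpha$ is a generator of $\mathbb{Q}(\beta_{1}, \ldots, \beta_{n})/ \mathbb{Q}$, then $$h(\alpha)\ge \frac{1}{240}\log\left(\frac{n}{9} \right).$$ In particular, $h(\alpha)$ tends to infinity with $n$.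
   Context: The hypothesis $\mathrm{Gal}(\mathbb{Q}(\beta_{1}, \ldots, \beta_{n})/\mathbb{Q}) = \mathfrak{A}_{n}$ means that, identifying a permutation $\sigma$ of $\{1,\dots,n\}$ with the automorphism sending $\beta_i\mapsto\beta_{\sigma(i)}$, the Galois group is exactly the alternating group $\mathfrak{A}_n$. For $\alpha\in\overline{\mathbb{Q}}$ of degree $d$ with conjugates $\alpha_1,\dots,\alpha_d$, $M(\alpha)=|a|\prod_{i=1}^d\max(1,|\alpha_i|)$ with $a$ the leading coefficient of the minimal polynomial of $\alpha$ over $\mathbb{Z}$, and $h(\alpha)=\log(M(\alpha))/d$. *)

theory Defs
  imports
    Complex_Main
    "HOL-Algebra.Sym_Groups"
    "HOL-Algebra.Generated_Fields"
    "HOL-Algebra.Algebraic_Closure_Type"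
begin

text \<open>Algebraic numbers are complex numbers throughout.\<close>

text \<open>
  Irreducibility is taken in \<open>\<int>[X]\<close>, so the polynomial is automatically primitive.
\<close>
definition is_min_int_poly :: "complex \<Rightarrow> int poly \<Rightarrow> bool" where
  "is_min_int_poly x p \<longleftrightarrow>
     comm_semiring_1_class.irreducible p \<and> Polynomial.lead_coeff p > 0 \<and>
     poly (map_poly of_int p) x = 0"

definition min_int_poly :: "complex \<Rightarrow> int poly" where
  "min_int_poly x = (THE p. is_min_int_poly x p)"

definition alg_degree :: "complex \<Rightarrow> nat" where
  "alg_degree x = Polynomial.degree (min_int_poly x)"

definition conjugates :: "complex \<Rightarrow> complex set" where
  "conjugates x = {z. poly (map_poly of_int (min_int_poly x)) z = 0}"

text \<open>The conjugates are pairwise distinct, so the product over the set is the usual one.\<close>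
definition mahler :: "complex \<Rightarrow> real" where
  "mahler x = real_of_int \<bar>Polynomial.lead_coeff (min_int_poly x)\<bar> *
     (\<Prod>z\<in>conjugates x. max 1 (cmod z))"

definition weil_height :: "complex \<Rightarrow> real" where
  "weil_height x = ln (mahler x) / real (alg_degree x)"

text \<open>\<open>\<rat>(S)\<close>: the subfield of the complex numbers generated by \<open>S\<close>.\<close>
definition rat_adjoin :: "complex set \<Rightarrow> complex set" where
  "rat_adjoin S = generate_field ring_of_type_algebra S"

text \<open>
  The elements of \<open>Gal(K/\<rat>)\<close>; \<open>extensional\<close> makes a map determined by its values on \<open>K\<close>.
\<close>
definition galois_auts :: "complex set \<Rightarrow> (complex \<Rightarrow> complex) set" where
  "galois_auts K =
     {\<phi> \<in> ring_iso (ring_of_type_algebra\<lparr>carrier := K\<rparr>) (ring_of_type_algebra\<lparr>carrier := K\<rparr>).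
        \<phi> \<in> extensional K \<and> (\<forall>q\<in>\<rat>. \<phi> q = q)}"

text \<open>
  The image of \<open>Gal(\<rat>(b\<^sub>1,\<dots>,b\<^sub>n)/\<rat>)\<close> in the symmetric group, \<open>\<sigma>\<close> corresponding
  to the automorphism with \<open>b\<^sub>i \<mapsto> b\<^bsub>\<sigma>(i)\<^esub>\<close>.
\<close>
definition galois_perms :: "nat \<Rightarrow> (nat \<Rightarrow> complex) \<Rightarrow> (nat \<Rightarrow> nat) set" where
  "galois_perms n b =
     {\<sigma>. \<sigma> permutes {1..n} \<and>
          (\<exists>\<phi>\<in>galois_auts (rat_adjoin (b ` {1..n})). \<forall>i\<in>{1..n}. \<phi> (b i) = b (\<sigma> i))}"

definition alternating_conjugates :: "nat \<Rightarrow> complex \<Rightarrow> (nat \<Rightarrow> complex) \<Rightarrow> bool" where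
  "alternating_conjugates n \<beta> b \<longleftrightarrow>
     algebraic_int \<beta> \<and> alg_degree \<beta> = n \<and> bij_betw b {1..n} (conjugates \<beta>) \<and>
     galois_perms n b = carrier (alt_group n)"

lemma map_poly_of_int_mult:
  "map_poly of_int (p * q) = map_poly of_int p * (map_poly of_int q :: complex poly)"
  by (rule poly_eqI) (simp add: coeff_map_poly coeff_mult)

lemma map_poly_of_int_smult:
  "map_poly of_int (Polynomial.smult c p) = Polynomial.smult (of_int c) (map_poly of_int p :: complex poly)"
  by (rule poly_eqI) (simp add: coeff_map_poly)

lemma map_poly_of_int_add:
  "map_poly of_int (p + q) = map_poly of_int p + (map_poly of_int q :: complex poly)"
  by (rule poly_eqI) (simp add: coeff_map_poly)

lemma degree_pos_of_root:
  fixes p :: "int poly"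
  assumes "p \<noteq> 0" "poly (map_poly of_int p) (x :: complex) = 0"
  shows "Polynomial.degree p > 0"
proof (rule ccontr)
  assume "\<not> Polynomial.degree p > 0"
  then obtain c where c: "p = [:c:]" by (auto elim: degree_eq_zeroE)
  with assms show False by (simp add: map_poly_pCons)
qed

lemma is_min_int_poly_exists:
  assumes "algebraic x"
  shows "\<exists>p. is_min_int_poly x p"
proof -
  obtain p :: "int poly" where p: "p \<noteq> 0" "poly (map_poly of_int p) x = 0"
    using assms by (elim algebraicE') auto
  have "\<exists>q. is_min_int_poly x q" if "p \<noteq> 0" "poly (map_poly of_int p) x = 0" for p :: "int poly"
    using that
  proof (induction p rule: prime_divisors_induct)
    case zero
    then show ?case by simp
  next
    case (unit p)
    have "Polynomial.degree p = 0"
      using unit(1) by (auto simp: is_unit_poly_iff)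
    then show ?case using degree_pos_of_root[OF unit(2,3)] by simp
  next
    case (factor q p)
    have pn: "p \<noteq> 0" using factor.prems by auto
    show ?case
    proof (cases "poly (map_poly of_int q) x = 0")
      case True
      have "normalize q = q" using factor(1) by simp
      moreover have "q \<noteq> 0" using factor.prems by auto
      ultimately have "unit_factor q = 1" by (metis unit_factor_normalize)
      then have "sgn (Polynomial.lead_coeff q) = 1"
        by (simp add: unit_factor_poly_def one_pCons)
      then have "Polynomial.lead_coeff q > 0" by (simp add: sgn_1_pos)
      moreover have "comm_semiring_1_class.irreducible q"
        using factor(1) by (simp add: prime_elem_imp_irreducible)
      ultimately show ?thesis using True unfolding is_min_int_poly_def by blast
    next
      case False
      then have "poly (map_poly of_int p) x = 0"
        using factor.prems by (simp add: map_poly_of_int_mult)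
      then show ?thesis using factor.IH pn by blast
    qed
  qed
  then show ?thesis using p by blast
qed

lemma is_min_int_poly_unique:
  assumes "is_min_int_poly x p" "is_min_int_poly x q"
  shows "p = q"
proof -
  let ?R = "\<lambda>m :: int poly. m \<noteq> 0 \<and> poly (map_poly of_int m) x = 0"
  have irr: "is_min_int_poly x p \<Longrightarrow> ?R p" for p
    by (auto simp: is_min_int_poly_def)
  obtain m where m: "?R m" and min: "\<And>m'. ?R m' \<Longrightarrow> Polynomial.degree m \<le> Polynomial.degree m'"
    using ex_has_least_nat[of ?R p Polynomial.degree] irr[OF assms(1)] by blast
  have degm: "Polynomial.degree m > 0" using degree_pos_of_root m by blast
  have dvd: "p dvd m" if p: "is_min_int_poly x p" for p
  proof -
    have mz: "m \<noteq> 0" using m by blast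
    obtain c s where cs: "c \<noteq> 0" "Polynomial.smult c p = m * s + pseudo_mod p m"
      using pseudo_mod(1)[OF mz] by blast
    have "poly (map_poly of_int (Polynomial.smult c p)) x = 0"
      using irr[OF p] by (simp add: map_poly_of_int_smult)
    then have "poly (map_poly of_int (pseudo_mod p m)) x = 0"
      unfolding cs(2) using m by (simp add: map_poly_of_int_add map_poly_of_int_mult)
    then have "pseudo_mod p m = 0"
      using pseudo_mod(2)[OF mz, of p] min[of "pseudo_mod p m"] by linarith
    then have eq: "Polynomial.smult c p = m * s" using cs by simp
    have "prime_elem p"
      using p by (auto simp: is_min_int_poly_def intro: irreducible_imp_prime_poly)
    moreover have "p dvd m * s" using eq by (metis dvd_refl dvd_smult)
    ultimately have "p dvd m \<or> p dvd s" by (simp add: prime_elem_dvd_mult_iff)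
    moreover have "\<not> p dvd s"
    proof
      assume "p dvd s"
      then obtain t where "s = p * t" by (rule dvdE)
      with eq have "p * [:c:] = p * (m * t)" by (simp add: algebra_simps)
      then have "[:c:] = m * t" using irr[OF p] by (metis mult_cancel_left)
      then have "m dvd [:c:]" by simp
      then have "Polynomial.degree m \<le> Polynomial.degree [:c:]"
        using cs(1) by (intro dvd_imp_degree_le) auto
      with degm show False by simp
    qed
    ultimately show ?thesis by blast
  qed
  have assoc: "q dvd p" if p: "is_min_int_poly x p" and q: "is_min_int_poly x q" for p q
  proof -
    obtain t where t: "m = p * t" using dvd[OF p] by (rule dvdE)
    have "t \<noteq> 0" "p \<noteq> 0" using t m by auto
    then have "Polynomial.degree m = Polynomial.degree p + Polynomial.degree t"
      using t by (simp add: degree_mult_eq)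
    with min[of p] irr[OF p] have "Polynomial.degree t = 0" by auto
    have "q dvd p * t" using dvd[OF q] t by simp
    moreover have "prime_elem q"
      using q by (auto simp: is_min_int_poly_def intro: irreducible_imp_prime_poly)
    ultimately have "q dvd p \<or> q dvd t" by (simp add: prime_elem_dvd_mult_iff)
    moreover have "\<not> q dvd t"
    proof
      assume "q dvd t"
      then have "Polynomial.degree q \<le> Polynomial.degree t" using \<open>t \<noteq> 0\<close> by (rule dvd_imp_degree_le)
      moreover have "Polynomial.degree q > 0" using degree_pos_of_root irr[OF q] by blast
      ultimately show False using \<open>Polynomial.degree t = 0\<close> by simp
    qed
    ultimately show ?thesis by blast
  qed
  obtain s where s: "p = q * s" using assoc[OF assms] by (rule dvdE)
  have "p dvd q" using assoc assms by blast
  have nz: "p \<noteq> 0" "q \<noteq> 0" using irr assms by auto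
  have "s dvd 1"
    using \<open>p dvd q\<close> s nz by (metis dvd_mult_cancel_left mult.right_neutral)
  then obtain c where c: "s = [:c:]" "c dvd 1" by (auto simp: is_unit_poly_iff)
  have "Polynomial.lead_coeff p = Polynomial.lead_coeff q * c" using s c by simp
  then have "c > 0"
    using assms by (metis is_min_int_poly_def zero_less_mult_pos)
  then have "c = 1" using c(2) by simp
  then show ?thesis using s c by simp
qed

text \<open>Well-definedness of the minimal polynomial.\<close>
lemma is_min_int_poly_min_int_poly:
  assumes "algebraic x"
  shows "is_min_int_poly x (min_int_poly x)"
  unfolding min_int_poly_def
  by (rule theI', rule ex_ex1I)
     (use is_min_int_poly_exists[OF assms] is_min_int_poly_unique in blast)+

end

theory Submission
  imports Defs "Jordan_Normal_Form.Char_Poly"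
begin

text \<open>
  For pairwise distinct indices, applying
  \<open>1 + (i j)(k l) - (i k)(j l) - (i l)(j k)\<close>, an element of the integral group ring of the
  alternating group, to \<open>\<alpha> = \<Sum> a\<^sub>m \<beta>\<^sub>m\<close> yields
  \<open>(a\<^sub>i + a\<^sub>j - a\<^sub>k - a\<^sub>l) (\<beta>\<^sub>i + \<beta>\<^sub>j - \<beta>\<^sub>k - \<beta>\<^sub>l)\<close>.
  The second factor never vanishes, since a 3-cycle would turn its vanishing into \<open>\<beta>\<^sub>j = \<beta>\<^sub>k\<close>.
  Hence every integral relation among the \<open>\<beta>\<^sub>m\<close> has constant coefficients, the stabilizer of \<open>\<alpha>\<close>
  is the stabilizer of the coefficient vector, and Galois theory gives the first part.
  For a generator, the product over the group of the above conjugates is divisible by the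
  corresponding power of \<open>a\<^sub>i + a\<^sub>j - a\<^sub>k - a\<^sub>l\<close>, while each conjugate is a signed sum of four conjugates
  of \<open>\<alpha>\<close>; therefore \<open>4 h(\<alpha>) + log 4 \<ge> log \<bar>a\<^sub>i + a\<^sub>j - a\<^sub>k - a\<^sub>l\<bar>\<close>, and the two largest
  and two smallest coefficients make the right-hand side at least \<open>log (2 n - 6)\<close>.
\<close>

subsection \<open>Embeddings of subfields of the complex numbers\<close>

text \<open>The convention \<open>inverse 0 = 0\<close> lets closure under inverses be stated
  without excluding zero.\<close>

locale csubfield =
  fixes F :: "complex set"
  assumes one_closed: "1 \<in> F"
    and add_closed: "x \<in> F \<Longrightarrow> y \<in> F \<Longrightarrow> x + y \<in> F"
    and mult_closed: "x \<in> F \<Longrightarrow> y \<in> F \<Longrightarrow> x * y \<in> F"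
    and uminus_closed: "x \<in> F \<Longrightarrow> - x \<in> F"
    and inverse_closed: "x \<in> F \<Longrightarrow> inverse x \<in> F"
begin

lemma zero_closed: "0 \<in> F"
  using add_closed[OF one_closed uminus_closed[OF one_closed]] by simp

lemma diff_closed: "x \<in> F \<Longrightarrow> y \<in> F \<Longrightarrow> x - y \<in> F"
  using add_closed[of x "- y"] uminus_closed by simp

lemma divide_closed: "x \<in> F \<Longrightarrow> y \<in> F \<Longrightarrow> x / y \<in> F"
  by (simp add: divide_inverse inverse_closed mult_closed)

lemma sum_closed: "(\<And>i. i \<in> I \<Longrightarrow> f i \<in> F) \<Longrightarrow> (\<Sum>i\<in>I. f i) \<in> F"
  by (induction I rule: infinite_finite_induct) (auto simp: zero_closed add_closed)

lemma prod_closed: "(\<And>i. i \<in> I \<Longrightarrow> f i \<in> F) \<Longrightarrow> (\<Prod>i\<in>I. f i) \<in> F"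
  by (induction I rule: infinite_finite_induct) (auto simp: one_closed mult_closed)

lemma of_nat_closed: "of_nat k \<in> F"
  by (induction k) (auto simp: zero_closed add_closed one_closed)

lemma of_int_closed: "of_int k \<in> F"
  by (cases k rule: int_cases2) (auto simp: of_nat_closed uminus_closed)

lemma Rats_subset: "\<rat> \<subseteq> F"
proof
  fix x :: complex assume "x \<in> \<rat>"
  then obtain r where "x = of_rat r" by (auto elim: Rats_cases)
  moreover obtain p q where "r = Rat.Fract p q" "q > 0" by (cases r) auto
  ultimately have "x = of_int p / of_int q" by (simp add: of_rat_rat)
  then show "x \<in> F" by (simp add: divide_closed of_int_closed)
qed

end

lemma csubfield_Rats: "csubfield \<rat>"
  by unfold_locales auto

section \<open>Polynomials over a subfield and division with remainder\<close>

definition coeffs_in :: "complex set \<Rightarrow> complex poly \<Rightarrow> bool" where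
  "coeffs_in F p \<longleftrightarrow> (\<forall>i. Polynomial.coeff p i \<in> F)"

context csubfield
begin

lemma coeffs_in_0: "coeffs_in F 0"
  by (simp add: coeffs_in_def zero_closed)

lemma coeffs_in_pCons: "c \<in> F \<Longrightarrow> coeffs_in F p \<Longrightarrow> coeffs_in F (pCons c p)"
  by (auto simp: coeffs_in_def coeff_pCons split: nat.splits)

lemma coeffs_in_add: "coeffs_in F p \<Longrightarrow> coeffs_in F q \<Longrightarrow> coeffs_in F (p + q)"
  by (simp add: coeffs_in_def add_closed)

lemma coeffs_in_uminus: "coeffs_in F p \<Longrightarrow> coeffs_in F (- p)"
  by (simp add: coeffs_in_def uminus_closed)

lemma coeffs_in_diff: "coeffs_in F p \<Longrightarrow> coeffs_in F q \<Longrightarrow> coeffs_in F (p - q)"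
  by (simp add: coeffs_in_def diff_closed)

lemma coeffs_in_mult: "coeffs_in F p \<Longrightarrow> coeffs_in F q \<Longrightarrow> coeffs_in F (p * q)"
  by (simp add: coeffs_in_def coeff_mult mult_closed sum_closed)

lemma coeffs_in_prod: "(\<And>i. i \<in> I \<Longrightarrow> coeffs_in F (f i)) \<Longrightarrow> coeffs_in F (\<Prod>i\<in>I. f i)"
proof (induction I rule: infinite_finite_induct)
  case (insert x I)
  then show ?case by (simp add: coeffs_in_mult)
qed (auto simp: one_pCons coeffs_in_pCons one_closed coeffs_in_0)

lemma coeffs_in_monom: "c \<in> F \<Longrightarrow> coeffs_in F (Polynomial.monom c k)"
  by (simp add: coeffs_in_def zero_closed)

lemma coeffs_in_map_of_int: "coeffs_in F (map_poly of_int p)"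
  by (simp add: coeffs_in_def coeff_map_poly of_int_closed)

text \<open>Long division: subtracting the multiple of \<open>f\<close> with the same leading term
  lowers the degree of \<open>p\<close>. The multiplier is a quotient of leading coefficients, so
  nothing leaves \<open>F\<close>.\<close>

lemma coeffs_in_division:
  assumes "coeffs_in F p" "coeffs_in F f" "f \<noteq> 0"
  shows "\<exists>q r. coeffs_in F q \<and> coeffs_in F r \<and> p = f * q + r \<and>
           (r = 0 \<or> Polynomial.degree r < Polynomial.degree f)"
  using assms(1)
proof (induction "Polynomial.degree p" arbitrary: p rule: less_induct)
  case less
  show ?case
  proof (cases "p = 0 \<or> Polynomial.degree p < Polynomial.degree f")
    case True
    then show ?thesis using less.prems coeffs_in_0
      by (intro exI[of _ "0 :: complex poly"] exI[of _ p]) auto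
  next
    case False
    then have p0: "p \<noteq> 0" and deg: "Polynomial.degree f \<le> Polynomial.degree p" by auto
    define c where "c = Polynomial.lead_coeff p / Polynomial.lead_coeff f"
    define m where "m = Polynomial.monom c (Polynomial.degree p - Polynomial.degree f)"
    have cF: "c \<in> F" using less.prems assms(2)
      by (simp add: c_def coeffs_in_def divide_closed)
    have c0: "c \<noteq> 0" using p0 assms(3) by (simp add: c_def)
    have m0: "m \<noteq> 0" using c0 by (simp add: m_def)
    have mF: "coeffs_in F m" unfolding m_def using cF by (rule coeffs_in_monom)
    define p' where "p' = p - f * m"
    have p'F: "coeffs_in F p'"
      unfolding p'_def by (intro coeffs_in_diff coeffs_in_mult less.prems assms(2) mF)
    have dfm: "Polynomial.degree (f * m) = Polynomial.degree p"
      using assms(3) m0 c0 deg by (simp add: degree_mult_eq) (simp add: m_def degree_monom_eq)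
    have lfm: "Polynomial.coeff (f * m) (Polynomial.degree p) = Polynomial.lead_coeff p"
      using lead_coeff_mult[of f m] assms(3) c0 dfm by (simp add: m_def degree_monom_eq c_def)
    have small: "p' = 0 \<or> Polynomial.degree p' < Polynomial.degree p"
    proof (rule disjCI)
      assume nz: "\<not> Polynomial.degree p' < Polynomial.degree p"
      have le: "Polynomial.degree p' \<le> Polynomial.degree p"
        unfolding p'_def using dfm by (intro degree_diff_le) auto
      with nz have "Polynomial.degree p' = Polynomial.degree p" by simp
      moreover have "Polynomial.coeff p' (Polynomial.degree p) = 0"
        unfolding p'_def using lfm by simp
      ultimately show "p' = 0" by (metis leading_coeff_0_iff)
    qed
    have "\<exists>q r. coeffs_in F q \<and> coeffs_in F r \<and> p' = f * q + r \<and>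
           (r = 0 \<or> Polynomial.degree r < Polynomial.degree f)"
    proof (cases "p' = 0")
      case True
      then show ?thesis using coeffs_in_0 by (intro exI[of _ "0 :: complex poly"]) auto
    next
      case False
      then show ?thesis using small less.hyps p'F by blast
    qed
    then obtain q r where "coeffs_in F q" "coeffs_in F r" "p' = f * q + r"
      "r = 0 \<or> Polynomial.degree r < Polynomial.degree f" by blast
    moreover from this(3) have "p = f * (q + m) + r" by (simp add: p'_def algebra_simps)
    ultimately show ?thesis using coeffs_in_add[OF _ mF] by blast
  qed
qed

end

section \<open>Minimal polynomials over a subfield and simple extensions\<close>

locale min_poly_over = csubfield +
  fixes p :: "complex poly" and x :: complex
  assumes coeffs_in: "coeffs_in F p"
    and nonzero: "p \<noteq> 0"
    and root: "poly p x = 0"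
    and minimal: "coeffs_in F f \<Longrightarrow> f \<noteq> 0 \<Longrightarrow> poly f x = 0 \<Longrightarrow> Polynomial.degree p \<le> Polynomial.degree f"
begin

lemma dvd_over:
  assumes "coeffs_in F f" "poly f x = 0"
  obtains q where "coeffs_in F q" "f = p * q"
proof -
  obtain q r where qr: "coeffs_in F q" "coeffs_in F r" "f = p * q + r"
    "r = 0 \<or> Polynomial.degree r < Polynomial.degree p"
    using coeffs_in_division[OF assms(1) coeffs_in nonzero] by blast
  have "poly r x = 0" using assms(2) root qr(3) by simp
  then have "r = 0" using qr minimal[of r] by fastforce
  then show thesis using that qr by simp
qed

lemma degree_pos: "Polynomial.degree p > 0"
proof (rule ccontr)
  assume "\<not> ?thesis"
  then obtain c where "p = [:c:]" by (auto elim: degree_eq_zeroE)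
  then show False using nonzero root by simp
qed

text \<open>Euclid's algorithm: dividing \<open>p\<close> by \<open>f\<close> leaves a remainder
  \<open>r\<close> of smaller degree with \<open>r(x) = - f(x) q(x)\<close>, so an inverse of
  \<open>r(x)\<close> yields one of \<open>f(x)\<close>. The recursion ends at nonzero
  constants.\<close>

lemma inverse_exists:
  assumes "coeffs_in F f" "f \<noteq> 0" "Polynomial.degree f < Polynomial.degree p"
  shows "\<exists>g. coeffs_in F g \<and> poly f x * poly g x = 1"
  using assms
proof (induction "Polynomial.degree f" arbitrary: f rule: less_induct)
  case less
  show ?case
  proof (cases "Polynomial.degree f = 0")
    case True
    then obtain c where c: "f = [:c:]" by (auto elim: degree_eq_zeroE)
    with less.prems have "c \<noteq> 0" "c \<in> F"
      by (auto simp: coeffs_in_def) (metis coeff_pCons_0)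
    with c show ?thesis
      by (intro exI[of _ "[:inverse c:]"]) (auto simp: coeffs_in_pCons coeffs_in_0 inverse_closed)
  next
    case False
    obtain q r where qr: "coeffs_in F q" "coeffs_in F r" "p = f * q + r"
      "r = 0 \<or> Polynomial.degree r < Polynomial.degree f"
      using coeffs_in_division[OF coeffs_in less.prems(1,2)] by blast
    have fx: "poly f x \<noteq> 0"
      using less.prems minimal[of f] by fastforce
    \<comment> \<open>Otherwise \<open>p = f * q\<close> with \<open>f(x)\<close> nonzero, and
      \<open>q\<close> annihilates \<open>x\<close> in degree smaller than that of
      \<open>p\<close>.\<close>
    have "r \<noteq> 0"
    proof
      assume "r = 0"
      with qr have pq: "p = f * q" by simp
      then have "q \<noteq> 0" using nonzero by auto
      have "poly q x = 0" using root fx pq by simp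
      with \<open>q \<noteq> 0\<close> qr(1) have "Polynomial.degree p \<le> Polynomial.degree q" by (intro minimal)
      moreover have "Polynomial.degree p = Polynomial.degree f + Polynomial.degree q"
        using pq \<open>q \<noteq> 0\<close> less.prems by (simp add: degree_mult_eq)
      ultimately show False using False by simp
    qed
    with qr less obtain g where g: "coeffs_in F g" "poly r x * poly g x = 1"
      by (metis less_trans)
    have "poly r x = - (poly f x * poly q x)"
      using root qr(3) by (simp add: add_eq_0_iff)
    with g have "poly f x * poly (- (q * g)) x = 1" by (simp add: algebra_simps)
    moreover have "coeffs_in F (- (q * g))" by (intro coeffs_in_uminus coeffs_in_mult qr g)
    ultimately show ?thesis by blast
  qed
qed

text \<open>This is the ring \<open>F[x]\<close>, which equals the field \<open>F(x)\<close> because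
  \<open>x\<close> is algebraic over \<open>F\<close>.\<close>

definition adjoin_root :: "complex set" where
  "adjoin_root = {poly f x |f. coeffs_in F f}"

lemma adjoin_rootI: "coeffs_in F f \<Longrightarrow> poly f x \<in> adjoin_root"
  by (auto simp: adjoin_root_def)

lemma csubfield_adjoin_root: "csubfield adjoin_root"
proof
  have "coeffs_in F [:1:]" by (simp add: coeffs_in_pCons one_closed coeffs_in_0)
  then show "1 \<in> adjoin_root" using adjoin_rootI[of "[:1:]"] by simp
next
  fix u v assume "u \<in> adjoin_root" "v \<in> adjoin_root"
  then obtain f g where fg: "coeffs_in F f" "coeffs_in F g" "u = poly f x" "v = poly g x"
    by (auto simp: adjoin_root_def)
  show "u + v \<in> adjoin_root"
    using adjoin_rootI[OF coeffs_in_add[OF fg(1,2)]] fg by simp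
  show "u * v \<in> adjoin_root"
    using adjoin_rootI[OF coeffs_in_mult[OF fg(1,2)]] fg by simp
next
  fix u assume "u \<in> adjoin_root"
  then obtain f where f: "coeffs_in F f" "u = poly f x" by (auto simp: adjoin_root_def)
  show "- u \<in> adjoin_root"
    using adjoin_rootI[OF coeffs_in_uminus[OF f(1)]] f by simp
  obtain q r where qr: "coeffs_in F q" "coeffs_in F r" "f = p * q + r"
    "r = 0 \<or> Polynomial.degree r < Polynomial.degree p"
    using coeffs_in_division[OF f(1) coeffs_in nonzero] by blast
  have u: "u = poly r x" using f qr(3) root by simp
  show "inverse u \<in> adjoin_root"
  proof (cases "r = 0")
    case True
    then show ?thesis using u adjoin_rootI[OF coeffs_in_0] by simp
  next
    case False
    then obtain g where "coeffs_in F g" "poly r x * poly g x = 1"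
      using inverse_exists[OF qr(2)] qr(4) by blast
    then show ?thesis using u adjoin_rootI by (metis inverse_unique)
  qed
qed

lemma subset_adjoin_root: "F \<subseteq> adjoin_root"
proof
  fix c assume "c \<in> F"
  then show "c \<in> adjoin_root"
    using adjoin_rootI[of "[:c:]"] by (simp add: coeffs_in_pCons coeffs_in_0)
qed

lemma in_adjoin_root: "x \<in> adjoin_root"
  using adjoin_rootI[of "[:0, 1:]"] by (simp add: coeffs_in_pCons coeffs_in_0 one_closed zero_closed)

end

lemma (in csubfield) min_poly_over_exists:
  assumes "coeffs_in F f" "f \<noteq> 0" "poly f x = 0"
  obtains p where "min_poly_over F p x"
proof -
  let ?R = "\<lambda>m. coeffs_in F m \<and> m \<noteq> 0 \<and> poly m x = 0"
  obtain m where "?R m" "\<And>m'. ?R m' \<Longrightarrow> Polynomial.degree m \<le> Polynomial.degree m'"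
    using ex_has_least_nat[of ?R f Polynomial.degree] assms by blast
  then have "min_poly_over F m x" by unfold_locales auto
  then show thesis by (rule that)
qed

text \<open>The map is total, but its values outside \<open>F\<close> are arbitrary. Extending an
  embedding thus means agreeing with it on the smaller field.\<close>

locale field_embedding = csubfield +
  fixes \<phi> :: "complex \<Rightarrow> complex"
  assumes hom_one: "\<phi> 1 = 1"
    and hom_add: "u \<in> F \<Longrightarrow> v \<in> F \<Longrightarrow> \<phi> (u + v) = \<phi> u + \<phi> v"
    and hom_mult: "u \<in> F \<Longrightarrow> v \<in> F \<Longrightarrow> \<phi> (u * v) = \<phi> u * \<phi> v"
begin

lemma hom_zero: "\<phi> 0 = 0"
  using hom_add[OF zero_closed zero_closed] by simp

lemma hom_uminus: "u \<in> F \<Longrightarrow> \<phi> (- u) = - \<phi> u"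
  using hom_add[of u "- u"] uminus_closed[of u] hom_zero by (simp add: eq_neg_iff_add_eq_0 add.commute)

lemma hom_diff: "u \<in> F \<Longrightarrow> v \<in> F \<Longrightarrow> \<phi> (u - v) = \<phi> u - \<phi> v"
  using hom_add[of u "- v"] uminus_closed[of v] hom_uminus[of v] by simp

lemma hom_eq_0_iff: "u \<in> F \<Longrightarrow> \<phi> u = 0 \<longleftrightarrow> u = 0"
  using hom_mult[of u "inverse u"] inverse_closed[of u] hom_one hom_zero
  by (metis mult_zero_left right_inverse zero_neq_one)

lemma hom_inverse: "u \<in> F \<Longrightarrow> \<phi> (inverse u) = inverse (\<phi> u)"
  using hom_mult[of u "inverse u"] inverse_closed[of u] hom_one hom_zero
  by (cases "u = 0") (auto intro: inverse_unique[symmetric])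

lemma inj_on_hom: "inj_on \<phi> F"
proof (rule inj_onI)
  fix u v assume uv: "u \<in> F" "v \<in> F" "\<phi> u = \<phi> v"
  then have "\<phi> (u - v) = 0" by (simp add: hom_diff)
  then show "u = v" using hom_eq_0_iff[of "u - v"] uv by (simp add: diff_closed)
qed

lemma hom_sum: "(\<And>i. i \<in> I \<Longrightarrow> f i \<in> F) \<Longrightarrow> \<phi> (\<Sum>i\<in>I. f i) = (\<Sum>i\<in>I. \<phi> (f i))"
  by (induction I rule: infinite_finite_induct) (auto simp: hom_zero hom_add sum_closed)

lemma hom_prod: "(\<And>i. i \<in> I \<Longrightarrow> f i \<in> F) \<Longrightarrow> \<phi> (\<Prod>i\<in>I. f i) = (\<Prod>i\<in>I. \<phi> (f i))"
  by (induction I rule: infinite_finite_induct) (auto simp: hom_one hom_mult prod_closed)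

lemma hom_of_nat: "\<phi> (of_nat k) = of_nat k"
  by (induction k) (auto simp: hom_zero hom_add hom_one one_closed of_nat_closed)

lemma hom_of_int: "\<phi> (of_int k) = of_int k"
  by (cases k rule: int_cases2) (auto simp: hom_of_nat hom_uminus of_nat_closed)

lemma csubfield_image:
  assumes "csubfield G" "G \<subseteq> F"
  shows "csubfield (\<phi> ` G)"
proof -
  interpret G: csubfield G by fact
  note [simp] = subsetD[OF assms(2)]
  show ?thesis
  proof
    show "1 \<in> \<phi> ` G" using G.one_closed hom_one by (metis imageI)
  next
    fix x y assume "x \<in> \<phi> ` G" "y \<in> \<phi> ` G"
    then obtain u v where "u \<in> G" "v \<in> G" "x = \<phi> u" "y = \<phi> v" by blast
    then have "x + y = \<phi> (u + v)" "x * y = \<phi> (u * v)" "u + v \<in> G" "u * v \<in> G"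
      by (auto simp: hom_add hom_mult G.add_closed G.mult_closed)
    then show "x + y \<in> \<phi> ` G" "x * y \<in> \<phi> ` G" by auto
  next
    fix x assume "x \<in> \<phi> ` G"
    then obtain u where "u \<in> G" "x = \<phi> u" by blast
    then have "- x = \<phi> (- u)" "inverse x = \<phi> (inverse u)" "- u \<in> G" "inverse u \<in> G"
      by (auto simp: hom_uminus hom_inverse G.uminus_closed G.inverse_closed)
    then show "- x \<in> \<phi> ` G" "inverse x \<in> \<phi> ` G" by auto
  qed
qed

lemma csubfield_vimage:
  assumes "csubfield G"
  shows "csubfield {u \<in> F. \<phi> u \<in> G}"
proof -
  interpret G: csubfield G by fact
  show ?thesis
    by unfold_locales
      (auto simp: hom_one hom_add hom_mult hom_uminus hom_inverse one_closed add_closed mult_closed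
        uminus_closed inverse_closed G.one_closed G.add_closed G.mult_closed G.uminus_closed
        G.inverse_closed)
qed

lemma csubfield_fixed: "csubfield {u \<in> F. \<phi> u = u}"
  by unfold_locales
    (auto simp: hom_one hom_add hom_mult hom_uminus hom_inverse one_closed add_closed mult_closed
      uminus_closed inverse_closed)

lemma hom_Rats: "q \<in> \<rat> \<Longrightarrow> \<phi> q = q"
  using csubfield.Rats_subset[OF csubfield_fixed] by blast

lemma map_poly_hom_add:
  "coeffs_in F f \<Longrightarrow> coeffs_in F g \<Longrightarrow> map_poly \<phi> (f + g) = map_poly \<phi> f + map_poly \<phi> g"
  by (rule poly_eqI) (simp add: coeff_map_poly hom_zero coeffs_in_def hom_add)

lemma map_poly_hom_diff:
  "coeffs_in F f \<Longrightarrow> coeffs_in F g \<Longrightarrow> map_poly \<phi> (f - g) = map_poly \<phi> f - map_poly \<phi> g"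
  by (rule poly_eqI) (simp add: coeff_map_poly hom_zero coeffs_in_def hom_diff)

lemma map_poly_hom_mult:
  "coeffs_in F f \<Longrightarrow> coeffs_in F g \<Longrightarrow> map_poly \<phi> (f * g) = map_poly \<phi> f * map_poly \<phi> g"
  by (rule poly_eqI)
    (simp add: coeff_map_poly hom_zero coeffs_in_def coeff_mult hom_sum hom_mult mult_closed)

lemma map_poly_hom_prod:
  "(\<And>i. i \<in> I \<Longrightarrow> coeffs_in F (f i)) \<Longrightarrow> map_poly \<phi> (\<Prod>i\<in>I. f i) = (\<Prod>i\<in>I. map_poly \<phi> (f i))"
  by (induction I rule: infinite_finite_induct)
    (auto simp: map_poly_1' hom_one map_poly_hom_mult coeffs_in_prod)

lemma hom_poly:
  assumes "coeffs_in F f" "x \<in> F"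
  shows "\<phi> (poly f x) = poly (map_poly \<phi> f) (\<phi> x)"
  using assms(1)
proof (induction f)
  case (pCons c f)
  have c: "c \<in> F" "coeffs_in F f"
    using pCons.prems by (auto simp: coeffs_in_def coeff_pCons split: nat.splits)
  have "poly f x \<in> F"
    using c(2) assms(2)
  proof (induction f)
    case (pCons d f)
    have "d \<in> F" "coeffs_in F f"
      using pCons.prems by (auto simp: coeffs_in_def coeff_pCons split: nat.splits)
    with pCons show ?case by (simp add: add_closed mult_closed)
  qed (simp add: zero_closed)
  then show ?case
    using c pCons assms(2) by (simp add: Polynomial.map_poly_pCons hom_zero hom_add hom_mult mult_closed)
qed (simp add: hom_zero)

lemma hom_root_int_poly:
  assumes "poly (map_poly of_int p) x = 0" "x \<in> F"
  shows "poly (map_poly of_int p) (\<phi> x) = 0"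
proof -
  have "map_poly \<phi> (map_poly of_int p) = map_poly of_int p"
    by (rule poly_eqI) (simp add: coeff_map_poly hom_zero hom_of_int)
  then show ?thesis
    using hom_poly[OF coeffs_in_map_of_int[of p] assms(2)] assms(1) by (simp add: hom_zero)
qed

lemma field_embedding_subset:
  assumes "csubfield G" "G \<subseteq> F"
  shows "field_embedding G \<phi>"
proof -
  interpret G: csubfield G by fact
  show ?thesis using assms(2) by unfold_locales (auto simp: hom_one intro!: hom_add hom_mult)
qed

text \<open>The extension sends \<open>f(x)\<close> to the value at \<open>y\<close> of the
  transported polynomial. Two polynomials with the same value at \<open>x\<close> differ by a
  multiple of \<open>p\<close>, and the image of \<open>p\<close> vanishes at
  \<open>y\<close>.\<close>

lemma extend_simple:
  assumes "min_poly_over F p x" "poly (map_poly \<phi> p) y = 0"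
  obtains G \<psi> where "field_embedding G \<psi>" "F \<subseteq> G" "x \<in> G" "\<psi> x = y" "\<And>u. u \<in> F \<Longrightarrow> \<psi> u = \<phi> u"
proof -
  interpret mp: min_poly_over F p x by fact
  \<comment> \<open>A polynomial is chosen for each element of \<open>F(x)\<close>; the claim
    \<open>\<psi>\<close> below shows that the choice does not matter.\<close>
  define rep where "rep u = (SOME f. coeffs_in F f \<and> poly f x = u)" for u
  define \<psi> where "\<psi> u = poly (map_poly \<phi> (rep u)) y" for u
  have \<psi>: "\<psi> (poly f x) = poly (map_poly \<phi> f) y" if f: "coeffs_in F f" for f
  proof -
    have "coeffs_in F (rep (poly f x)) \<and> poly (rep (poly f x)) x = poly f x"
      unfolding rep_def by (rule someI[of _ f]) (use f in auto)
    then have g: "coeffs_in F (rep (poly f x))" "poly (rep (poly f x)) x = poly f x" by auto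
    then obtain q where q: "coeffs_in F q" "rep (poly f x) - f = p * q"
      using mp.dvd_over[of "rep (poly f x) - f"] f by (auto simp: coeffs_in_diff)
    have "map_poly \<phi> (rep (poly f x)) - map_poly \<phi> f = map_poly \<phi> p * map_poly \<phi> q"
      using q(2) map_poly_hom_diff[OF g(1) f] map_poly_hom_mult[OF mp.coeffs_in q(1)] by simp
    then have "poly (map_poly \<phi> (rep (poly f x))) y - poly (map_poly \<phi> f) y = 0"
      using assms(2) by (metis poly_diff poly_mult mult_zero_left)
    then show ?thesis by (simp add: \<psi>_def)
  qed
  have const: "\<psi> u = \<phi> u" if "u \<in> F" for u
    using \<psi>[of "[:u:]"] that by (simp add: Polynomial.map_poly_pCons hom_zero coeffs_in_pCons coeffs_in_0)
  interpret E: csubfield mp.adjoin_root by (rule mp.csubfield_adjoin_root)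
  have "field_embedding mp.adjoin_root \<psi>"
  proof
    show "\<psi> 1 = 1" using const[OF one_closed] hom_one by simp
  next
    fix u v assume "u \<in> mp.adjoin_root" "v \<in> mp.adjoin_root"
    then obtain f g where fg: "coeffs_in F f" "coeffs_in F g" "u = poly f x" "v = poly g x"
      by (auto simp: mp.adjoin_root_def)
    have "\<psi> (poly (f + g) x) = poly (map_poly \<phi> f) y + poly (map_poly \<phi> g) y"
      using fg by (subst \<psi>) (auto simp: coeffs_in_add map_poly_hom_add)
    then show "\<psi> (u + v) = \<psi> u + \<psi> v" using fg by (simp add: \<psi>)
    have "\<psi> (poly (f * g) x) = poly (map_poly \<phi> f) y * poly (map_poly \<phi> g) y"
      using fg by (subst \<psi>) (auto simp: coeffs_in_mult map_poly_hom_mult)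
    then show "\<psi> (u * v) = \<psi> u * \<psi> v" using fg by (simp add: \<psi>)
  qed
  moreover have "\<psi> x = y"
    using \<psi>[of "[:0, 1:]"]
    by (simp add: Polynomial.map_poly_pCons hom_zero hom_one coeffs_in_pCons coeffs_in_0 zero_closed one_closed)
  ultimately show thesis
    using mp.subset_adjoin_root mp.in_adjoin_root const by (intro that)
qed

end

lemma field_embedding_id: "csubfield F \<Longrightarrow> field_embedding F (\<lambda>x. x)"
  by (simp add: field_embedding_def field_embedding_axioms_def)

text \<open>The elements of \<open>S\<close> are adjoined one at a time. At each stage the
  transported minimal polynomial has a complex root, which serves as the image of the new
  element.\<close>

lemma field_embedding_extend:
  assumes "finite S" "field_embedding F \<phi>"
    and "\<And>x. x \<in> S \<Longrightarrow> algebraic x"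
  shows "\<exists>G \<psi>. field_embedding G \<psi> \<and> F \<subseteq> G \<and> S \<subseteq> G \<and> (\<forall>u\<in>F. \<psi> u = \<phi> u)"
  using assms(1,3)
proof (induction S rule: finite_induct)
  case empty
  then show ?case using assms(2) by blast
next
  case (insert x S)
  then obtain G \<psi> where G: "field_embedding G \<psi>" "F \<subseteq> G" "S \<subseteq> G" "\<forall>u\<in>F. \<psi> u = \<phi> u"
    by blast
  interpret field_embedding G \<psi> by fact
  obtain f :: "int poly" where f: "f \<noteq> 0" "poly (map_poly of_int f) x = 0"
    using insert.prems[of x] by (auto elim: algebraicE')
  have "map_poly of_int f \<noteq> (0 :: complex poly)"
    using f(1) by (auto simp: poly_eq_iff coeff_map_poly)
  then obtain p where p: "min_poly_over G p x"
    using min_poly_over_exists[OF coeffs_in_map_of_int _ f(2)] by blast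
  interpret mp: min_poly_over G p x by fact
  \<comment> \<open>Injectivity of \<open>\<psi>\<close> keeps the leading coefficient nonzero, so
    the transported polynomial is not constant.\<close>
  have "Polynomial.degree (map_poly \<psi> p) = Polynomial.degree p"
    using mp.nonzero mp.coeffs_in
    by (intro antisym degree_le le_degree)
      (auto simp: coeff_map_poly hom_zero hom_eq_0_iff coeffs_in_def coeff_eq_0)
  then have "\<not> constant (poly (map_poly \<psi> p))"
    using mp.degree_pos by (simp add: constant_degree)
  then obtain y where "poly (map_poly \<psi> p) y = 0"
    using fundamental_theorem_of_algebra by blast
  then obtain H \<chi> where "field_embedding H \<chi>" "G \<subseteq> H" "x \<in> H" "\<And>u. u \<in> G \<Longrightarrow> \<chi> u = \<psi> u"
    using extend_simple[OF p] by metis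
  then show ?case using G by (intro exI[of _ H] exI[of _ \<chi>]) auto
qed

text \<open>A minimal polynomial has only simple roots because its derivative has smaller degree.\<close>
lemma (in csubfield) embedding_moving:
  assumes "algebraic z" "z \<notin> F"
  obtains G \<psi> where "field_embedding G \<psi>" "F \<subseteq> G" "z \<in> G" "\<And>u. u \<in> F \<Longrightarrow> \<psi> u = u" "\<psi> z \<noteq> z"
proof -
  interpret I: field_embedding F "\<lambda>x. x"
    by (rule field_embedding_id) unfold_locales
  obtain f :: "int poly" where f: "f \<noteq> 0" "poly (map_poly of_int f) z = 0"
    using assms(1) by (elim algebraicE') auto
  have "map_poly of_int f \<noteq> (0 :: complex poly)"
    using f(1) by (auto simp: poly_eq_iff coeff_map_poly)
  then obtain p where p: "min_poly_over F p z"
    using min_poly_over_exists[OF coeffs_in_map_of_int _ f(2)] by blast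
  interpret mp: min_poly_over F p z by fact
  \<comment> \<open>A linear minimal polynomial would express \<open>z\<close> by elements of
    \<open>F\<close>.\<close>
  have deg: "Polynomial.degree p \<noteq> 1"
  proof
    assume d1: "Polynomial.degree p = 1"
    then have nz: "Polynomial.coeff p 1 \<noteq> 0" using mp.nonzero by (metis leading_coeff_0_iff)
    have "poly p z = Polynomial.coeff p 0 + Polynomial.coeff p 1 * z"
      using d1 by (simp add: poly_altdef)
    then have "Polynomial.coeff p 1 * z = - Polynomial.coeff p 0"
      using mp.root by (simp add: add_eq_0_iff)
    then have "z = - Polynomial.coeff p 0 / Polynomial.coeff p 1"
      using nz by (simp add: field_simps)
    then show False
      using assms(2) mp.coeffs_in by (simp add: coeffs_in_def divide_closed uminus_closed)
  qed
  \<comment> \<open>After the root \<open>z\<close> is split off, any root \<open>y\<close> of the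
    remaining factor is a candidate for the new image of \<open>z\<close>.\<close>
  have "[:- z, 1:] dvd p" using mp.root by (simp add: poly_eq_0_iff_dvd)
  then obtain q where q: "p = [:- z, 1:] * q" by (rule dvdE)
  have q0: "q \<noteq> 0" using q mp.nonzero by auto
  have "Polynomial.degree p = Suc (Polynomial.degree q)"
    using q q0 by (simp add: degree_mult_eq del: mult_pCons_left)
  then have "\<not> constant (poly q)" using deg by (simp add: constant_degree)
  then obtain y where y: "poly q y = 0" using fundamental_theorem_of_algebra by blast
  have "y \<noteq> z"
  proof
    assume "y = z"
    have pd: "pderiv p \<noteq> 0" using mp.degree_pos by (simp add: pderiv_eq_0_iff)
    have "pderiv p = [:- z, 1:] * pderiv q + q" by (simp add: q pderiv_mult pderiv_pCons del: mult_pCons_left)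
    then have "poly (pderiv p) z = 0" using y \<open>y = z\<close> by simp
    moreover have "coeffs_in F (pderiv p)"
      using mp.coeffs_in of_nat_closed mult_closed by (auto simp: coeffs_in_def coeff_pderiv simp del: of_nat_Suc)
    ultimately have "Polynomial.degree p \<le> Polynomial.degree (pderiv p)"
      using pd by (intro mp.minimal)
    then show False using mp.degree_pos by (simp add: degree_pderiv)
  qed
  have "poly (map_poly (\<lambda>x. x) p) y = 0" using q y by (simp add: map_poly_idI)
  then show thesis using I.extend_simple[OF p] that \<open>y \<noteq> z\<close> by metis
qed

subsection \<open>Algebraic integers\<close>

definition int_span :: "complex set \<Rightarrow> complex set" where
  "int_span G = {\<Sum>g\<in>G. of_int (c g) * g |c. True}"

lemma int_spanI: "u = (\<Sum>g\<in>G. of_int (c g) * g) \<Longrightarrow> u \<in> int_span G"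
  by (auto simp: int_span_def)

lemma int_span_add:
  assumes "u \<in> int_span G" "v \<in> int_span G"
  shows "u + v \<in> int_span G"
proof -
  obtain c d where "u = (\<Sum>g\<in>G. of_int (c g) * g)" "v = (\<Sum>g\<in>G. of_int (d g) * g)"
    using assms by (auto simp: int_span_def)
  then have "u + v = (\<Sum>g\<in>G. of_int (c g + d g) * g)"
    by (simp add: sum.distrib algebra_simps)
  then show ?thesis by (rule int_spanI)
qed

lemma int_span_of_int_mult:
  assumes "u \<in> int_span G"
  shows "of_int k * u \<in> int_span G"
proof -
  obtain c where "u = (\<Sum>g\<in>G. of_int (c g) * g)"
    using assms by (auto simp: int_span_def)
  then have "of_int k * u = (\<Sum>g\<in>G. of_int (k * c g) * g)"
    by (simp add: sum_distrib_left algebra_simps)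
  then show ?thesis by (rule int_spanI)
qed

lemma int_span_base:
  assumes "finite G" "g \<in> G"
  shows "g \<in> int_span G"
proof -
  have "g = (\<Sum>h\<in>G. of_int (if h = g then 1 else 0) * h)"
    using assms by (simp add: if_distrib[of "\<lambda>x. of_int x * _"] cong: if_cong)
  then show ?thesis by (rule int_spanI)
qed

lemma int_span_0: "0 \<in> int_span G"
  by (rule int_spanI[of _ "\<lambda>_. 0"]) simp

lemma int_span_sum: "(\<And>i. i \<in> I \<Longrightarrow> f i \<in> int_span G) \<Longrightarrow> (\<Sum>i\<in>I. f i) \<in> int_span G"
  by (induction I rule: infinite_finite_induct) (auto intro: int_span_0 int_span_add)

lemma int_span_mult_closed:
  assumes "\<And>g. g \<in> G \<Longrightarrow> x * g \<in> int_span G" "u \<in> int_span G"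
  shows "x * u \<in> int_span G"
proof -
  obtain c where "u = (\<Sum>g\<in>G. of_int (c g) * g)"
    using assms by (auto simp: int_span_def)
  then have "x * u = (\<Sum>g\<in>G. of_int (c g) * (x * g))"
    by (simp add: sum_distrib_left algebra_simps)
  then show ?thesis using assms(1) by (simp add: int_span_sum int_span_of_int_mult)
qed

text \<open>Multiplication by \<open>x\<close> is given by an integer matrix with eigenvalue \<open>x\<close>.\<close>
lemma algebraic_int_if_int_span_invariant:
  assumes "finite G" "1 \<in> G" "\<And>g. g \<in> G \<Longrightarrow> x * g \<in> int_span G"
  shows "algebraic_int x"
proof -
  obtain gs where gs: "set gs = G" "distinct gs" using finite_distinct_list[OF assms(1)] by blast
  define n where "n = length gs"
  have "\<forall>g\<in>G. \<exists>c. x * g = (\<Sum>h\<in>G. of_int (c h) * h)"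
    using assms(3) by (fastforce simp: int_span_def)
  then obtain c where c: "\<And>g. g \<in> G \<Longrightarrow> x * g = (\<Sum>h\<in>G. of_int (c g h) * h)" by metis
  \<comment> \<open>Row \<open>i\<close> holds the coordinates of \<open>x * gs ! i\<close>, so the
    vector of the generators themselves is the eigenvector.\<close>
  define M :: "int mat" where "M = mat n n (\<lambda>(i, j). c (gs ! i) (gs ! j))"
  define A :: "complex mat" where "A = map_mat of_int M"
  define v :: "complex vec" where "v = vec n (\<lambda>i. gs ! i)"
  have M: "M \<in> carrier_mat n n" by (simp add: M_def)
  then have A: "A \<in> carrier_mat n n" by (simp add: A_def)
  have sum_nth: "(\<Sum>h\<in>G. f h) = (\<Sum>j<n. f (gs ! j))" for f :: "complex \<Rightarrow> complex"
    using sum.reindex_bij_betw[OF bij_betw_nth[OF gs(2) _ gs(1)[symmetric]], of "{..<n}" f]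
    by (simp add: n_def)
  have "A *\<^sub>v v = x \<cdot>\<^sub>v v"
  proof (rule eq_vecI)
    fix i assume "i < dim_vec (x \<cdot>\<^sub>v v)"
    then have i: "i < n" by (simp add: v_def)
    have "(A *\<^sub>v v) $ i = (\<Sum>j<n. of_int (c (gs ! i) (gs ! j)) * gs ! j)"
      using i by (simp add: A_def M_def v_def scalar_prod_def lessThan_atLeast0)
    also have "\<dots> = x * gs ! i"
      using i c[of "gs ! i"] sum_nth gs(1) nth_mem[of i gs] by (simp add: n_def)
    finally show "(A *\<^sub>v v) $ i = (x \<cdot>\<^sub>v v) $ i" using i by (simp add: v_def)
  qed (use A in \<open>simp add: v_def\<close>)
  \<comment> \<open>The generator \<open>1\<close> supplies a nonzero entry.\<close>
  moreover have "v \<noteq> 0\<^sub>v n"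
  proof
    assume v0: "v = 0\<^sub>v n"
    obtain i where "i < n" "gs ! i = 1"
      using assms(2) gs(1) by (metis in_set_conv_nth n_def)
    moreover from this have "vec_index v i = 0" using v0 by simp
    ultimately show False by (simp add: v_def)
  qed
  ultimately have "eigenvalue A x"
    unfolding eigenvalue_def eigenvector_def using A by (intro exI[of _ v]) (auto simp: v_def)
  then have "poly (char_poly A) x = 0" using eigenvalue_root_char_poly[OF A] by simp
  moreover have "char_poly A = map_poly of_int (char_poly M)"
    unfolding A_def by (rule of_int_hom.char_poly_hom[OF M])
  moreover have "Polynomial.lead_coeff (char_poly M) = 1"
    using degree_monic_char_poly[OF M] by simp
  ultimately show ?thesis
    unfolding algebraic_int_altdef_ipoly by (intro exI[of _ "char_poly M"]) auto
qed

text \<open>The monic equation solved for its top power, in the form that reduces powers of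
  \<open>x\<close> to finitely many.\<close>

lemma algebraic_int_power_eq:
  assumes "algebraic_int (x :: complex)"
  obtains d c where "d > 0" "x ^ d = (\<Sum>i<d. of_int (c i) * x ^ i)"
proof -
  obtain p :: "int poly" where p: "poly (map_poly of_int p) x = 0" "Polynomial.lead_coeff p = 1"
    using assms by (auto simp: algebraic_int_altdef_ipoly)
  let ?d = "Polynomial.degree p"
  have "?d > 0" using p(1) by (intro degree_pos_of_root[of _ x]) (use p in auto)
  moreover have "poly (map_poly of_int p) x = (\<Sum>i\<le>?d. of_int (Polynomial.coeff p i) * x ^ i)"
    by (simp add: poly_altdef coeff_map_poly)
  then have "x ^ ?d = (\<Sum>i<?d. of_int (- Polynomial.coeff p i) * x ^ i)"
    using p by (simp add: lessThan_Suc_atMost[symmetric] sum_negf add_eq_0_iff2)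
  ultimately show thesis by (rule that)
qed

text \<open>The finitely many products \<open>x ^ i * y ^ j\<close> with exponents below the degrees
  of the two monic equations span an additive group stable under multiplication by \<open>x\<close>
  and by \<open>y\<close>, hence by their sum and product.\<close>

lemma
  assumes x: "algebraic_int (x :: complex)" and y: "algebraic_int y"
  shows algebraic_int_add: "algebraic_int (x + y)"
    and algebraic_int_mult: "algebraic_int (x * y)"
proof -
  obtain d c where d: "d > 0" "x ^ d = (\<Sum>i<d. of_int (c i) * x ^ i)"
    using algebraic_int_power_eq[OF x] by blast
  obtain e c' where e: "e > 0" "y ^ e = (\<Sum>j<e. of_int (c' j) * y ^ j)"
    using algebraic_int_power_eq[OF y] by blast
  define G where "G = (\<lambda>(i, j). x ^ i * y ^ j) ` ({..<d} \<times> {..<e})"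
  have fin: "finite G" by (simp add: G_def)
  have one: "1 \<in> G" unfolding G_def by (rule image_eqI[of _ _ "(0, 0)"]) (use d e in auto)
  have mono: "x ^ i * y ^ j \<in> int_span G" if "i < d" "j < e" for i j
    by (rule int_span_base[OF fin]) (use that in \<open>auto simp: G_def\<close>)
  have x_mult: "x * g \<in> int_span G" if "g \<in> G" for g
  proof -
    obtain i j where ij: "i < d" "j < e" "g = x ^ i * y ^ j" using \<open>g \<in> G\<close> by (auto simp: G_def)
    show ?thesis
    proof (cases "Suc i < d")
      case True
      then show ?thesis using mono[of "Suc i" j] ij by (simp add: mult.assoc)
    next
      case False
      then have "Suc i = d" using ij by simp
      \<comment> \<open>The exponent has left the range, and the monic relation brings it
        back.\<close>
      then have "x * g = x ^ d * y ^ j" using ij by (metis mult.assoc power_Suc)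
      also have "\<dots> = (\<Sum>i<d. of_int (c i) * (x ^ i * y ^ j))"
        by (simp add: d(2) sum_distrib_right mult.assoc)
      finally show ?thesis using mono ij by (auto intro!: int_span_sum int_span_of_int_mult)
    qed
  qed
  have y_mult: "y * g \<in> int_span G" if "g \<in> G" for g
  proof -
    obtain i j where ij: "i < d" "j < e" "g = x ^ i * y ^ j" using \<open>g \<in> G\<close> by (auto simp: G_def)
    show ?thesis
    proof (cases "Suc j < e")
      case True
      then show ?thesis using mono[of i "Suc j"] ij by (simp add: mult_ac)
    next
      case False
      then have "Suc j = e" using ij by simp
      then have "y * g = x ^ i * y ^ e" using ij by (metis mult.left_commute power_Suc)
      also have "\<dots> = (\<Sum>j<e. of_int (c' j) * (x ^ i * y ^ j))"
        by (simp add: e(2) sum_distrib_left mult_ac)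
      finally show ?thesis using mono ij by (auto intro!: int_span_sum int_span_of_int_mult)
    qed
  qed
  show "algebraic_int (x + y)"
    by (rule algebraic_int_if_int_span_invariant[OF fin one])
      (simp add: distrib_right int_span_add x_mult y_mult)
  show "algebraic_int (x * y)"
    by (rule algebraic_int_if_int_span_invariant[OF fin one])
      (simp add: mult.assoc int_span_mult_closed[OF x_mult] y_mult)
qed

lemma algebraic_int_sum:
  "(\<And>i. i \<in> I \<Longrightarrow> algebraic_int (f i :: complex)) \<Longrightarrow> algebraic_int (\<Sum>i\<in>I. f i)"
  by (induction I rule: infinite_finite_induct) (auto intro: algebraic_int_add)

lemma algebraic_int_prod:
  "(\<And>i. i \<in> I \<Longrightarrow> algebraic_int (f i :: complex)) \<Longrightarrow> algebraic_int (\<Prod>i\<in>I. f i)"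
  by (induction I rule: infinite_finite_induct) (auto intro: algebraic_int_mult)

text \<open>Up to sign the coefficients are elementary symmetric functions of the roots. A further
  linear factor adds a shifted coefficient to a multiple of an old one.\<close>

lemma algebraic_int_coeff_prod_linear:
  fixes f :: "'a \<Rightarrow> complex"
  assumes "\<And>i. i \<in> I \<Longrightarrow> algebraic_int (f i)"
  shows "algebraic_int (Polynomial.coeff (\<Prod>i\<in>I. [:- f i, 1:]) k)"
  using assms
proof (induction I arbitrary: k rule: infinite_finite_induct)
  case (insert x I)
  have "algebraic_int (- f x * Polynomial.coeff (\<Prod>i\<in>I. [:- f i, 1:]) j)" for j
    using insert by (intro algebraic_int_mult algebraic_int_minus) auto
  then show ?case
    using insert algebraic_int_add[of "- f x * _" "Polynomial.coeff (\<Prod>i\<in>I. [:- f i, 1:]) _"]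
    by (cases k) (auto simp: coeff_pCons)
qed (auto simp: int_imp_algebraic_int)

subsection \<open>Fields generated by the conjugates\<close>

lemma
  fixes x :: complex
  shows a_inv_ring_of_type_algebra: "\<ominus>\<^bsub>ring_of_type_algebra\<^esub> x = - x"
    and m_inv_ring_of_type_algebra: "x \<noteq> 0 \<Longrightarrow> inv\<^bsub>ring_of_type_algebra\<^esub> x = inverse x"
proof -
  interpret R: field "ring_of_type_algebra :: complex ring" by (rule field_from_type_algebra)
  show "\<ominus>\<^bsub>ring_of_type_algebra\<^esub> x = - x"
    by (rule R.minus_equality) (auto simp: ring_of_type_algebra_def)
  show "inv\<^bsub>ring_of_type_algebra\<^esub> x = inverse x" if "x \<noteq> 0"
    by (rule R.comm_inv_char) (use that in \<open>auto simp: ring_of_type_algebra_def\<close>)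
qed

lemma csubfield_rat_adjoin: "csubfield (rat_adjoin S)"
proof -
  let ?R = "ring_of_type_algebra :: complex ring"
  \<comment> \<open>Obtained as \<open>1 + (- 1)\<close>. It is needed for
    \<open>inverse 0 = 0\<close>, since \<open>generate_field\<close> provides inverses of nonzero
    elements only.\<close>
  have 0: "0 \<in> generate_field ?R S"
    using generate_field.eng_add[OF generate_field.one generate_field.a_inv[OF generate_field.one], of ?R S]
    by (simp add: a_inv_ring_of_type_algebra) (simp add: ring_of_type_algebra_def)
  show ?thesis
  proof
    show "1 \<in> rat_adjoin S"
      using generate_field.one[of ?R S] by (simp add: rat_adjoin_def ring_of_type_algebra_def)
  next
    fix x y assume "x \<in> rat_adjoin S" "y \<in> rat_adjoin S"
    then show "x + y \<in> rat_adjoin S" "x * y \<in> rat_adjoin S"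
      using generate_field.eng_add[of x ?R S y] generate_field.eng_mult[of x ?R S y]
      by (simp_all add: rat_adjoin_def ring_of_type_algebra_def)
  next
    fix x assume x: "x \<in> rat_adjoin S"
    then show "- x \<in> rat_adjoin S"
      using generate_field.a_inv[of x ?R S] by (simp add: rat_adjoin_def a_inv_ring_of_type_algebra)
    have "\<zero>\<^bsub>?R\<^esub> = 0" by (simp add: ring_of_type_algebra_def)
    then show "inverse x \<in> rat_adjoin S"
      using x 0 generate_field.m_inv[of x ?R S]
      by (cases "x = 0") (auto simp: rat_adjoin_def m_inv_ring_of_type_algebra)
  qed
qed

lemma subset_rat_adjoin: "S \<subseteq> rat_adjoin S"
  by (auto simp: rat_adjoin_def intro: generate_field.incl)

lemma rat_adjoin_minimal:
  assumes "csubfield F" "S \<subseteq> F"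
  shows "rat_adjoin S \<subseteq> F"
proof
  interpret csubfield F by fact
  let ?R = "ring_of_type_algebra :: complex ring"
  have R: "\<one>\<^bsub>?R\<^esub> = 1" "\<zero>\<^bsub>?R\<^esub> = 0" "x \<oplus>\<^bsub>?R\<^esub> y = x + y" "x \<otimes>\<^bsub>?R\<^esub> y = x * y" for x y
    by (simp_all add: ring_of_type_algebra_def)
  fix x assume "x \<in> rat_adjoin S"
  then have "x \<in> generate_field ?R S" by (simp add: rat_adjoin_def)
  then show "x \<in> F"
    using assms(2)
    by (induction rule: generate_field.induct)
      (auto simp: R a_inv_ring_of_type_algebra m_inv_ring_of_type_algebra one_closed add_closed
        mult_closed uminus_closed inverse_closed)
qed

lemma rat_adjoin_mono_iff: "rat_adjoin S \<subseteq> rat_adjoin T \<longleftrightarrow> S \<subseteq> rat_adjoin T"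
  using rat_adjoin_minimal[OF csubfield_rat_adjoin] subset_rat_adjoin[of S] by (meson subset_trans)

section \<open>Galois automorphisms as embeddings, and divisibility by the minimal
  polynomial\<close>

lemma field_embedding_of_galois_aut:
  assumes "csubfield K" "\<phi> \<in> galois_auts K"
  shows "field_embedding K \<phi>"
proof -
  interpret csubfield K by fact
  have "\<phi> \<in> Ring.ring_hom (ring_of_type_algebra\<lparr>carrier := K\<rparr>) (ring_of_type_algebra\<lparr>carrier := K\<rparr>)"
    using assms(2) by (auto simp: galois_auts_def ring_iso_def)
  then show ?thesis
    by unfold_locales (auto simp: Ring.ring_hom_def ring_of_type_algebra_def)
qed

text \<open>Restriction makes the map extensional, as \<open>galois_auts\<close> demands. The
  rationals are fixed because the fixed points form a subfield.\<close>

lemma (in field_embedding) restrict_in_galois_auts: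
  assumes "\<phi> ` F = F"
  shows "restrict \<phi> F \<in> galois_auts F"
proof -
  have "bij_betw (restrict \<phi> F) F F"
    using inj_on_hom assms by (auto simp: bij_betw_def inj_on_def)
  then have "restrict \<phi> F \<in> ring_iso (ring_of_type_algebra\<lparr>carrier := F\<rparr>) (ring_of_type_algebra\<lparr>carrier := F\<rparr>)"
    using assms
    by (auto simp: ring_iso_def Ring.ring_hom_def ring_of_type_algebra_def hom_one hom_add hom_mult
        one_closed add_closed mult_closed)
  then show ?thesis
    using Rats_subset hom_Rats by (auto simp: galois_auts_def)
qed

text \<open>Some normalized prime factor of \<open>p\<close> vanishes at \<open>x\<close>. It has
  positive leading coefficient, so by uniqueness it is the minimal polynomial.\<close>

lemma min_int_poly_dvd:
  assumes "p \<noteq> 0" "poly (map_poly of_int p) x = 0"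
  shows "min_int_poly x dvd p"
proof -
  have alg: "algebraic x"
    using assms by (intro algebraicI'[of "map_poly of_int p"]) (auto simp: coeff_map_poly poly_eq_iff)
  have "\<exists>q. is_min_int_poly x q \<and> q dvd p"
    using assms
  proof (induction p rule: prime_divisors_induct)
    case (unit p)
    then have "Polynomial.degree p = 0" by (auto simp: is_unit_poly_iff)
    then show ?case using degree_pos_of_root[OF unit(2,3)] by simp
  next
    case (factor q p)
    show ?case
    proof (cases "poly (map_poly of_int q) x = 0")
      case True
      have q0: "q \<noteq> 0" using factor.prems by auto
      have "normalize q = q" using factor(1) by simp
      then have "sgn (Polynomial.lead_coeff q) = 1"
        using q0 by (metis unit_factor_normalize unit_factor_poly_def one_pCons pCons_eq_iff unit_factor_int_def)
      then have "is_min_int_poly x q"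
        using True factor(1) unfolding is_min_int_poly_def
        by (simp add: prime_elem_imp_irreducible sgn_1_pos)
      then show ?thesis by auto
    next
      case False
      then have "poly (map_poly of_int p) x = 0" "p \<noteq> 0"
        using factor.prems by (auto simp: map_poly_of_int_mult)
      then show ?thesis using factor.IH by auto
    qed
  qed simp
  then show ?thesis
    using is_min_int_poly_unique is_min_int_poly_min_int_poly[OF alg] by blast
qed

text \<open>The minimal polynomial divides every monic integer polynomial annihilating
  \<open>x\<close>, so all conjugates satisfy the same monic equation.\<close>

lemma algebraic_int_conjugate:
  assumes "algebraic_int x" "z \<in> conjugates x"
  shows "algebraic_int z"
proof -
  obtain p :: "int poly" where p: "poly (map_poly of_int p) x = 0" "Polynomial.lead_coeff p = 1"
    using assms by (auto simp: algebraic_int_altdef_ipoly)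
  then have "min_int_poly x dvd p" by (intro min_int_poly_dvd) auto
  then obtain q where "p = min_int_poly x * q" by (rule dvdE)
  then have "poly (map_poly of_int p) z = 0"
    using assms(2) by (simp add: conjugates_def map_poly_of_int_mult)
  then show ?thesis using p(2) by (auto simp: algebraic_int_altdef_ipoly)
qed

section \<open>Even permutations of the conjugates versus embeddings of the field they
  generate\<close>

locale alternating_field =
  fixes n :: nat and \<beta> :: complex and b :: "nat \<Rightarrow> complex"
  assumes n_ge: "n \<ge> 5" and alternating: "alternating_conjugates n \<beta> b"
begin

abbreviation "K \<equiv> rat_adjoin (b ` {1..n})"
abbreviation "Alt \<equiv> carrier (alt_group n)"

sublocale K: csubfield K by (rule csubfield_rat_adjoin)

lemma b_in_K: "i \<in> {1..n} \<Longrightarrow> b i \<in> K"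
  by (rule subsetD[OF subset_rat_adjoin imageI])

lemma bij_betw_b: "bij_betw b {1..n} (conjugates \<beta>)"
  using alternating by (simp only: alternating_conjugates_def)

lemma galois_perms_eq_Alt: "galois_perms n b = Alt"
  using alternating by (simp only: alternating_conjugates_def)

lemma algebraic_int_b: "i \<in> {1..n} \<Longrightarrow> algebraic_int (b i)"
  using alternating bij_betwE[OF bij_betw_b]
  by (auto simp: alternating_conjugates_def intro: algebraic_int_conjugate[of \<beta> "b i"])

lemmas b_eq_iff = inj_on_eq_iff[OF bij_betw_imp_inj_on[OF bij_betw_b]]

lemma perm_embedding:
  assumes "\<sigma> \<in> Alt"
  obtains \<phi> where "field_embedding K \<phi>" "\<And>i. i \<in> {1..n} \<Longrightarrow> \<phi> (b i) = b (\<sigma> i)"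
proof -
  have "\<sigma> \<in> galois_perms n b" using assms by (simp only: galois_perms_eq_Alt)
  then obtain \<phi> where "\<phi> \<in> galois_auts K" "\<And>i. i \<in> {1..n} \<Longrightarrow> \<phi> (b i) = b (\<sigma> i)"
    by (auto simp: galois_perms_def)
  then show thesis
    using that field_embedding_of_galois_aut[OF K.csubfield_axioms] by blast
qed

text \<open>An embedding maps roots of the minimal polynomial of \<open>\<beta>\<close> to roots,
  hence permutes the \<open>b i\<close> and maps \<open>K\<close> onto itself. It is then a Galois
  automorphism, and the hypothesis on the Galois group makes the permutation even.\<close>

lemma embedding_perm:
  assumes "field_embedding K \<phi>"
  obtains \<sigma> where "\<sigma> \<in> Alt" "\<And>i. i \<in> {1..n} \<Longrightarrow> \<phi> (b i) = b (\<sigma> i)"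
proof -
  interpret field_embedding K \<phi> by fact
  have sub: "\<phi> ` b ` {1..n} \<subseteq> b ` {1..n}"
  proof (clarify)
    fix i assume "i \<in> {1..n}"
    then have "b i \<in> conjugates \<beta>" "b i \<in> K" using bij_betw_imp_surj_on[OF bij_betw_b] b_in_K by auto
    then have "\<phi> (b i) \<in> conjugates \<beta>" by (auto simp: conjugates_def intro: hom_root_int_poly)
    then show "\<phi> (b i) \<in> b ` {1..n}" using bij_betw_imp_surj_on[OF bij_betw_b] by simp
  qed
  have inj: "inj_on \<phi> (b ` {1..n})"
    using inj_on_hom subset_rat_adjoin by (rule inj_on_subset)
  have eq: "\<phi> ` b ` {1..n} = b ` {1..n}"
    using sub inj by (intro endo_inj_surj) auto
  \<comment> \<open>The identity outside \<open>{1..n}\<close> is what \<open>permutes\<close>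
    requires.\<close>
  define \<sigma> where "\<sigma> i = (if i \<in> {1..n} then inv_into {1..n} b (\<phi> (b i)) else i)" for i
  have \<sigma>: "\<phi> (b i) = b (\<sigma> i)" "\<sigma> i \<in> {1..n}" if "i \<in> {1..n}" for i
  proof -
    have "\<phi> (b i) \<in> b ` {1..n}" using sub that by blast
    then show "\<phi> (b i) = b (\<sigma> i)" "\<sigma> i \<in> {1..n}"
      using that by (auto simp: \<sigma>_def f_inv_into_f inv_into_into simp del: atLeastAtMost_iff)
  qed
  have "inj_on \<sigma> {1..n}"
  proof (rule inj_onI)
    fix i j assume ij: "i \<in> {1..n}" "j \<in> {1..n}" "\<sigma> i = \<sigma> j"
    then have "\<phi> (b i) = \<phi> (b j)" using \<sigma> by simp
    then have "b i = b j" using inj ij by (auto simp: inj_on_def)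
    then show "i = j" using ij b_eq_iff by blast
  qed
  moreover have "\<sigma> ` {1..n} \<subseteq> {1..n}" using \<sigma>(2) by blast
  ultimately have "bij_betw \<sigma> {1..n} {1..n}"
    by (simp add: bij_betw_def endo_inj_surj)
  then have perm: "\<sigma> permutes {1..n}"
    by (rule bij_imp_permutes) (simp add: \<sigma>_def del: atLeastAtMost_iff)
  \<comment> \<open>Both inclusions follow from minimality of \<open>K\<close>: its preimage and its
    image under \<open>\<phi>\<close> are subfields containing every \<open>b i\<close>.\<close>
  have "\<phi> ` K = K"
  proof
    have "b ` {1..n} \<subseteq> {u \<in> K. \<phi> u \<in> K}"
      using sub subset_rat_adjoin[of "b ` {1..n}"] by blast
    then show "\<phi> ` K \<subseteq> K"
      using rat_adjoin_minimal[OF csubfield_vimage[OF K.csubfield_axioms]] by blast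
    have "csubfield (\<phi> ` K)" by (rule csubfield_image[OF K.csubfield_axioms]) simp
    moreover have "b ` {1..n} \<subseteq> \<phi> ` K"
      using eq subset_rat_adjoin[of "b ` {1..n}"] by blast
    ultimately show "K \<subseteq> \<phi> ` K" by (rule rat_adjoin_minimal)
  qed
  then have "restrict \<phi> K \<in> galois_auts K" by (rule restrict_in_galois_auts)
  moreover have "restrict \<phi> K (b i) = b (\<sigma> i)" if "i \<in> {1..n}" for i
    using that \<sigma>(1) b_in_K by simp
  ultimately have "\<sigma> \<in> galois_perms n b"
    unfolding galois_perms_def using perm by blast
  then have "\<sigma> \<in> Alt" by (simp only: galois_perms_eq_Alt)
  then show thesis using \<sigma>(1) by (rule that)
qed

text \<open>The fixed-field half of Galois theory: an embedding over \<open>F\<close> that moves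
  \<open>x\<close> is extended to all conjugates, restricted to \<open>K\<close>, and read as an
  even permutation. Hence an element of \<open>K\<close> fixed by every such permutation lies in
  \<open>F\<close>.\<close>

lemma perm_embedding_moving:
  assumes "csubfield F" "x \<in> K" "algebraic x" "x \<notin> F"
  obtains \<sigma> \<phi> where "\<sigma> \<in> Alt" "field_embedding K \<phi>" "\<And>i. i \<in> {1..n} \<Longrightarrow> \<phi> (b i) = b (\<sigma> i)"
    "\<And>u. u \<in> F \<Longrightarrow> \<phi> u = u" "\<phi> x \<noteq> x"
proof -
  interpret F: csubfield F by fact
  obtain G \<psi> where G: "field_embedding G \<psi>" "F \<subseteq> G" "x \<in> G" "\<And>u. u \<in> F \<Longrightarrow> \<psi> u = u" "\<psi> x \<noteq> x"
    using F.embedding_moving[OF assms(3,4)] by blast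
  have "algebraic y" if "y \<in> b ` {1..n}" for y
    using that algebraic_int_b algebraic_int_imp_algebraic by blast
  then have "\<exists>H \<chi>. field_embedding H \<chi> \<and> G \<subseteq> H \<and> b ` {1..n} \<subseteq> H \<and> (\<forall>u\<in>G. \<chi> u = \<psi> u)"
    by (intro field_embedding_extend[OF _ G(1)]) auto
  then obtain H \<chi> where H: "field_embedding H \<chi>" "G \<subseteq> H" "b ` {1..n} \<subseteq> H" "\<And>u. u \<in> G \<Longrightarrow> \<chi> u = \<psi> u"
    by blast
  interpret H: field_embedding H \<chi> by fact
  have "K \<subseteq> H" by (rule rat_adjoin_minimal[OF H.csubfield_axioms H(3)])
  then have emb: "field_embedding K \<chi>" by (rule H.field_embedding_subset[OF K.csubfield_axioms])
  obtain \<sigma> where \<sigma>: "\<sigma> \<in> Alt" "\<And>i. i \<in> {1..n} \<Longrightarrow> \<chi> (b i) = b (\<sigma> i)"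
    using embedding_perm[OF emb] by blast
  show thesis
  proof (rule that[OF \<sigma>(1) emb \<sigma>(2)])
    show "\<chi> u = u" if "u \<in> F" for u using that G H by auto
    show "\<chi> x \<noteq> x" using G H by auto
  qed
qed

end

subsection \<open>Permutations and coefficients\<close>

text \<open>The two pairs may overlap, so that 3-cycles written as
  \<open>transpose i j \<circ> transpose j k\<close> are covered as well.\<close>

lemma double_transposition_in_alt_group:
  assumes "{i, j, k, l} \<subseteq> {1..n}" "i \<noteq> j" "k \<noteq> l"
  shows "transpose i j \<circ> transpose k l \<in> carrier (alt_group n)"
  using assms
  by (auto simp: alt_group_carrier evenperm_comp evenperm_swap permutation_swap_id
      intro!: permutes_compose permutes_swap_id)

text \<open>Both sides say that at most one index is redundant. Dropping one index of the only equal
  pair makes \<open>a\<close> injective; conversely, a system of representatives misses at most one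
  index, and every equal pair consists of that index and its representative.\<close>

lemma card_equal_pairs_le_1_iff:
  fixes a :: "nat \<Rightarrow> 'a"
  shows "card {(i, j). i \<in> {1..n} \<and> j \<in> {1..n} \<and> i < j \<and> a i = a j} \<le> 1 \<longleftrightarrow> card (a ` {1..n}) \<ge> n - 1"
    (is "card ?P \<le> 1 \<longleftrightarrow> _")
proof -
  have fin: "finite ?P"
    by (rule finite_subset[of _ "{1..n} \<times> {1..n}"]) auto
  have unique: "card ?P \<le> 1 \<longleftrightarrow> (\<forall>p\<in>?P. \<forall>q\<in>?P. p = q)"
    using card_le_Suc0_iff_eq[OF fin] by simp
  show ?thesis
  proof
    assume "card ?P \<le> 1"
    show "card (a ` {1..n}) \<ge> n - 1"
    proof (cases "?P = {}")
      case True
      have "inj_on a {1..n}"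
      proof (rule inj_onI)
        fix i j assume ij: "i \<in> {1..n}" "j \<in> {1..n}" "a i = a j"
        have "(i, j) \<notin> ?P" "(j, i) \<notin> ?P" using True by blast+
        then show "i = j" using ij by auto
      qed
      then show ?thesis by (simp add: card_image)
    next
      case False
      then obtain p where p: "p \<in> ?P" by blast
      obtain i j where "p = (i, j)" by (cases p)
      with p have ij: "(i, j) \<in> ?P" by simp
      have "inj_on a ({1..n} - {j})"
      proof (rule inj_onI)
        fix k l assume kl: "k \<in> {1..n} - {j}" "l \<in> {1..n} - {j}" "a k = a l"
        show "k = l"
        proof (rule ccontr)
          assume "k \<noteq> l"
          then have "(k, l) \<in> ?P \<or> (l, k) \<in> ?P" using kl by auto
          then have "(k, l) = (i, j) \<or> (l, k) = (i, j)"
            using ij \<open>card ?P \<le> 1\<close> unique by blast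
          then show False using kl by auto
        qed
      qed
      then have "card (a ` ({1..n} - {j})) = n - 1" using ij by (simp add: card_image)
      moreover have "card (a ` ({1..n} - {j})) \<le> card (a ` {1..n})"
        by (intro card_mono image_mono) auto
      ultimately show ?thesis by simp
    qed
  next
    assume large: "card (a ` {1..n}) \<ge> n - 1"
    \<comment> \<open>\<open>S\<close> contains one index for each value of \<open>a\<close>; the
      size of the image leaves at most one index outside.\<close>
    obtain S where S: "S \<subseteq> {1..n}" "inj_on a S" "a ` S = a ` {1..n}"
      using subset_image_inj[of "a ` {1..n}" a "{1..n}"] by auto
    have "card S = card (a ` {1..n})" using S card_image by metis
    then have "card ({1..n} - S) \<le> Suc 0"
      using large S(1) by (simp add: card_Diff_subset finite_subset)
    then have e: "x = y" if "x \<in> {1..n} - S" "y \<in> {1..n} - S" for x y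
      using that card_le_Suc0_iff_eq[of "{1..n} - S"] by blast
    have "p = q" if pq: "p \<in> ?P" "q \<in> ?P" for p q
    proof -
      obtain i j k l where ijkl: "p = (i, j)" "q = (k, l)" by (cases p, cases q)
      have P: "i \<in> {1..n}" "j \<in> {1..n}" "i < j" "a i = a j"
        "k \<in> {1..n}" "l \<in> {1..n}" "k < l" "a k = a l" using pq ijkl by auto
      have S_inj: "x = y" if "x \<in> S" "y \<in> S" "a x = a y" for x y
        using that S(2) by (auto simp: inj_on_def)
      have ne: "i \<noteq> j" "k \<noteq> l" using P by auto
      \<comment> \<open>Both indices inside contradicts injectivity on \<open>S\<close>, and both
        outside contradicts the uniqueness of the omitted index.\<close>
      consider "i \<in> S" "j \<notin> S" | "i \<notin> S" "j \<in> S" using S_inj e P ne by blast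
      note c1 = this
      consider "k \<in> S" "l \<notin> S" | "k \<notin> S" "l \<in> S" using S_inj e P ne by blast
      note c2 = this
      show ?thesis
      proof (cases rule: c1)
        case 1
        show ?thesis
        proof (cases rule: c2)
          case c: 1
          have "j = l" using 1 c e P by blast
          moreover then have "i = k" using 1 c S_inj P by metis
          ultimately show ?thesis using ijkl by simp
        next
          \<comment> \<open>Here \<open>(k, l)\<close> would be \<open>(j, i)\<close>, against
            \<open>i < j\<close> and \<open>k < l\<close>.\<close>
          case c: 2
          have "j = k" using 1 c e P by blast
          moreover then have "i = l" using 1 c S_inj P by metis
          ultimately show ?thesis using P by simp
        qed
      next
        case 2
        show ?thesis
        proof (cases rule: c2)
          case c: 1
          have "i = l" using 2 c e P by blast
          moreover then have "j = k" using 2 c S_inj P by metis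
          ultimately show ?thesis using P by simp
        next
          case c: 2
          have "i = k" using 2 c e P by blast
          moreover then have "j = l" using 2 c S_inj P by metis
          ultimately show ?thesis using ijkl by simp
        qed
      qed
    qed
    then show "card ?P \<le> 1" unfolding unique by blast
  qed
qed

lemma card_le_Max_minus_Min:
  assumes "finite T" "T \<noteq> {}"
  shows "int (card T) \<le> Max T - Min T + 1"
proof -
  have "T \<subseteq> {Min T..Max T}" using assms by auto
  then have "card T \<le> card {Min T..Max T}" by (intro card_mono) auto
  moreover have "Min T \<le> Max T" using assms by (meson Max_in Min_le)
  ultimately show ?thesis by (simp add: le_nat_iff)
qed

text \<open>At least \<open>n - 1\<close> distinct integers have spread at least
  \<open>n - 2\<close>. Removing the extremes leaves at least \<open>n - 3\<close> values of spread
  at least \<open>n - 4\<close>, and the two spreads add up to \<open>2 * n - 6\<close>.\<close>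

lemma exists_spread_quadruple:
  fixes a :: "nat \<Rightarrow> int"
  assumes "card (a ` {1..n}) \<ge> n - 1" "n \<ge> 5"
  obtains i j k l where "{i, j, k, l} \<subseteq> {1..n}" "distinct [i, j, k, l]"
    "a i + a j - a k - a l \<ge> 2 * int n - 6"
proof -
  define T where "T = a ` {1..n}"
  define T' where "T' = T - {Max T, Min T}"
  have fin: "finite T" "finite T'" by (auto simp: T_def T'_def)
  have cT: "card T \<ge> n - 1" using assms by (simp add: T_def)
  have "card {Max T, Min T} \<le> 2" by (simp add: card_insert_if)
  then have cT': "card T' \<ge> n - 3"
    using cT diff_card_le_card_Diff[of "{Max T, Min T}" T] by (simp add: T'_def)
  have ne: "T \<noteq> {}" "T' \<noteq> {}" using cT cT' assms(2) by auto
  have T_diff: "Max T - Min T \<ge> int n - 2"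
    using card_le_Max_minus_Min[OF fin(1) ne(1)] cT assms(2) by linarith
  have T'_diff: "Max T' - Min T' \<ge> int n - 4"
    using card_le_Max_minus_Min[OF fin(2) ne(2)] cT' assms(2) by linarith
  have "Max T' \<in> T'" "Min T' \<in> T'" "Max T \<in> T" "Min T \<in> T" using fin ne by auto
  then obtain i j k l where ix: "i \<in> {1..n}" "a i = Max T" "j \<in> {1..n}" "a j = Max T'"
    "k \<in> {1..n}" "a k = Min T" "l \<in> {1..n}" "a l = Min T'"
    by (auto simp: T_def T'_def simp del: atLeastAtMost_iff)
  have "a j \<noteq> a i" "a j \<noteq> a k" "a l \<noteq> a i" "a l \<noteq> a k"
    using \<open>Max T' \<in> T'\<close> \<open>Min T' \<in> T'\<close> unfolding ix T'_def by blast+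
  \<comment> \<open>Both spreads are positive because \<open>n \<ge> 5\<close>.\<close>
  moreover have "a i \<noteq> a k" "a j \<noteq> a l"
    using T_diff T'_diff assms(2) unfolding ix by linarith+
  ultimately have "distinct [i, j, k, l]" by auto
  moreover have "{i, j, k, l} \<subseteq> {1..n}" using ix by blast
  moreover have "a i + a j - a k - a l \<ge> 2 * int n - 6"
    using T_diff T'_diff unfolding ix by linarith
  ultimately show thesis using that by blast
qed

text \<open>
  In the group ring, \<open>1 + (i j)(k l) - (i k)(j l) - (i l)(j k)\<close> acts on the permutation module
  as an operator of rank one.
\<close>
lemma klein_four_sum:
  fixes f :: "nat \<Rightarrow> complex" and c :: "nat \<Rightarrow> int"
  assumes "finite I" "{i, j, k, l} \<subseteq> I" "distinct [i, j, k, l]"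
  shows "(\<Sum>m\<in>I. of_int (c m) * f m) + (\<Sum>m\<in>I. of_int (c m) * f ((transpose i j \<circ> transpose k l) m))
      - (\<Sum>m\<in>I. of_int (c m) * f ((transpose i k \<circ> transpose j l) m))
      - (\<Sum>m\<in>I. of_int (c m) * f ((transpose i l \<circ> transpose j k) m))
    = of_int (c i + c j - c k - c l) * (f i + f j - f k - f l)"
proof -
  define g where "g m = f m + f ((transpose i j \<circ> transpose k l) m)
      - f ((transpose i k \<circ> transpose j l) m) - f ((transpose i l \<circ> transpose j k) m)" for m
  \<comment> \<open>Away from the four indices all three permutations fix \<open>m\<close>, and the
    signs cancel.\<close>
  have "g m = 0" if "m \<notin> {i, j, k, l}" for m
    using that by (simp add: g_def transpose_def)
  then have "(\<Sum>m\<in>I. of_int (c m) * g m) = (\<Sum>m\<in>{i, j, k, l}. of_int (c m) * g m)"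
    using assms by (intro sum.mono_neutral_right) auto
  also have "\<dots> = of_int (c i) * g i + of_int (c j) * g j + of_int (c k) * g k + of_int (c l) * g l"
    using assms(3) by (simp add: add.assoc)
  \<comment> \<open>\<open>g\<close> equals \<open>f i + f j - f k - f l\<close> at \<open>i\<close>
    and \<open>j\<close>, and its negative at \<open>k\<close> and \<open>l\<close>.\<close>
  also have "\<dots> = of_int (c i + c j - c k - c l) * (f i + f j - f k - f l)"
    using assms(3) by (simp add: g_def transpose_def algebra_simps)
  finally show ?thesis
    by (simp add: g_def sum.distrib sum_subtractf distrib_left right_diff_distrib)
qed

lemma obtain_two_more:
  assumes "n \<ge> 4" "j \<in> {1..n}" "k \<in> {1..n}" "j \<noteq> k"
  obtains i l :: nat where "{i, j, k, l} \<subseteq> {1..n}" "distinct [i, j, k, l]"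
proof -
  have "card ({1..n} - {j, k}) = n - 2" using assms by (simp add: card_Diff_subset)
  then have "2 \<le> card ({1..n} - {j, k})" using assms by simp
  then obtain S where "S \<subseteq> {1..n} - {j, k}" "card S = 2" by (meson obtain_subset_with_card_n)
  then obtain i l where "{i, l} \<subseteq> {1..n} - {j, k}" "i \<noteq> l" by (auto simp: card_2_iff)
  then show thesis using that[of i l] assms by auto
qed

subsection \<open>Conjugates of integral combinations\<close>

declare One_nat_def [simp del]
declare [[linarith_neq_limit = 2]]

context alternating_field
begin

text \<open>At \<open>id\<close> this is \<alpha>, and the automorphism of \<open>\<tau>\<close>
  sends it to \<open>conj_sum c (\<tau> \<circ> \<sigma>)\<close>. Composition on the right permutes
  the coefficients instead, which is how the group ring acts.\<close>

definition conj_sum :: "(nat \<Rightarrow> int) \<Rightarrow> (nat \<Rightarrow> nat) \<Rightarrow> complex" where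
  "conj_sum c \<sigma> = (\<Sum>i=1..n. of_int (c i) * b (\<sigma> i))"

lemma Alt_in: "\<sigma> \<in> Alt \<Longrightarrow> i \<in> {1..n} \<Longrightarrow> \<sigma> i \<in> {1..n}"
  by (simp add: alt_group_carrier permutes_in_image del: atLeastAtMost_iff)

lemma finite_Alt: "finite Alt"
  by (rule finite_subset[OF _ finite_permutations[of "{1..n}"]]) (auto simp: alt_group_carrier)

lemma Alt_comp: "\<sigma> \<in> Alt \<Longrightarrow> \<tau> \<in> Alt \<Longrightarrow> \<sigma> \<circ> \<tau> \<in> Alt"
  using group.is_monoid[OF alt_group_is_group] monoid.m_closed[of "alt_group n"]
  by (simp add: alt_group_mult)

lemma id_in_Alt: "id \<in> Alt"
  by (simp add: alt_group_carrier permutes_id)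

lemma bij_betw_Alt_left: "\<tau> \<in> Alt \<Longrightarrow> bij_betw (\<lambda>\<sigma>. \<tau> \<circ> \<sigma>) Alt Alt"
  using group.inj_on_cmult[OF alt_group_is_group, of \<tau> n] group.surj_const_mult[OF alt_group_is_group, of \<tau> n]
  by (simp add: bij_betw_def alt_group_mult)

lemma bij_betw_Alt_right: "\<tau> \<in> Alt \<Longrightarrow> bij_betw (\<lambda>\<sigma>. \<sigma> \<circ> \<tau>) Alt Alt"
proof (rule bij_betw_byWitness[where f' = "\<lambda>\<sigma>. \<sigma> \<circ> inv' \<tau>"])
  assume \<tau>: "\<tau> \<in> Alt"
  then have p: "\<tau> permutes {1..n}" by (simp add: alt_group_carrier)
  show "\<forall>\<sigma>\<in>Alt. \<sigma> \<circ> \<tau> \<circ> inv' \<tau> = \<sigma>" "\<forall>\<sigma>\<in>Alt. \<sigma> \<circ> inv' \<tau> \<circ> \<tau> = \<sigma>"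
    using permutes_inv_o[OF p] by (simp_all add: comp_assoc)
  show "(\<lambda>\<sigma>. \<sigma> \<circ> \<tau>) ` Alt \<subseteq> Alt" "(\<lambda>\<sigma>. \<sigma> \<circ> inv' \<tau>) ` Alt \<subseteq> Alt"
    using \<tau> Alt_comp alt_group_inv_closed by auto
qed

lemma conj_sum_in_K: "\<sigma> \<in> Alt \<Longrightarrow> conj_sum c \<sigma> \<in> K"
  unfolding conj_sum_def by (intro K.sum_closed K.mult_closed K.of_int_closed b_in_K Alt_in[of \<sigma>])

lemma algebraic_int_conj_sum: "\<sigma> \<in> Alt \<Longrightarrow> algebraic_int (conj_sum c \<sigma>)"
  unfolding conj_sum_def
  by (intro algebraic_int_sum algebraic_int_mult algebraic_int_b Alt_in[of \<sigma>]) (auto intro: int_imp_algebraic_int)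

lemma hom_conj_sum:
  assumes "field_embedding K \<phi>" "\<And>i. i \<in> {1..n} \<Longrightarrow> \<phi> (b i) = b (\<tau> i)" "\<sigma> \<in> Alt"
  shows "\<phi> (conj_sum c \<sigma>) = conj_sum c (\<tau> \<circ> \<sigma>)"
proof -
  interpret field_embedding K \<phi> by fact
  have "b (\<sigma> i) \<in> K" if "i \<in> {1..n}" for i using that Alt_in assms(3) b_in_K by blast
  then have "\<phi> (conj_sum c \<sigma>) = (\<Sum>i=1..n. of_int (c i) * \<phi> (b (\<sigma> i)))"
    unfolding conj_sum_def
    by (simp add: hom_sum hom_mult hom_of_int K.mult_closed K.of_int_closed del: atLeastAtMost_iff)
  also have "\<dots> = conj_sum c (\<tau> \<circ> \<sigma>)"
    unfolding conj_sum_def using assms(2) Alt_in[OF assms(3)] by (intro sum.cong) simp_all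
  finally show ?thesis .
qed

lemma klein_four_in_Alt:
  assumes "{i, j, k, l} \<subseteq> {1..n}" "distinct [i, j, k, l]"
  shows "transpose i j \<circ> transpose k l \<in> Alt" "transpose i k \<circ> transpose j l \<in> Alt"
    "transpose i l \<circ> transpose j k \<in> Alt"
  by (rule double_transposition_in_alt_group; use assms in \<open>auto simp del: atLeastAtMost_iff\<close>)+

lemma conj_sum_klein_four:
  assumes "{i, j, k, l} \<subseteq> {1..n}" "distinct [i, j, k, l]"
  shows "conj_sum c \<sigma> + conj_sum c (\<sigma> \<circ> (transpose i j \<circ> transpose k l))
      - conj_sum c (\<sigma> \<circ> (transpose i k \<circ> transpose j l))
      - conj_sum c (\<sigma> \<circ> (transpose i l \<circ> transpose j k))
    = of_int (c i + c j - c k - c l) * (b (\<sigma> i) + b (\<sigma> j) - b (\<sigma> k) - b (\<sigma> l))"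
  using klein_four_sum[OF _ assms, of c "\<lambda>m. b (\<sigma> m)"] by (simp add: conj_sum_def)

section \<open>Linear relations among the conjugates\<close>

lemma b_sums_distinct:
  assumes "{i, j, k, l} \<subseteq> {1..n}" "distinct [i, j, k, l]"
  shows "b i + b j \<noteq> b k + b l"
proof
  assume eq: "b i + b j = b k + b l"
  \<comment> \<open>The 3-cycle \<open>j\<close> to \<open>k\<close> to \<open>l\<close> to
    \<open>j\<close> turns the equality into \<open>b i + b k = b l + b j\<close>; subtracting the
    two gives \<open>2 * (b j - b k) = 0\<close>.\<close>
  let ?\<sigma> = "transpose j k \<circ> transpose k l"
  have "?\<sigma> \<in> Alt" by (rule double_transposition_in_alt_group) (use assms in \<open>auto simp del: atLeastAtMost_iff\<close>)
  then obtain \<phi> where \<phi>: "field_embedding K \<phi>" "\<And>m. m \<in> {1..n} \<Longrightarrow> \<phi> (b m) = b (?\<sigma> m)"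
    using perm_embedding by blast
  interpret field_embedding K \<phi> by fact
  have "\<phi> (b i) + \<phi> (b j) = \<phi> (b k) + \<phi> (b l)"
    using eq assms(1) hom_add b_in_K by (metis insert_subset)
  moreover have "?\<sigma> i = i" "?\<sigma> j = k" "?\<sigma> k = l" "?\<sigma> l = j"
    using assms(2) by (auto simp: transpose_def)
  ultimately have "b i + b k = b l + b j"
    using \<phi>(2) assms(1) by (metis insert_subset)
  moreover have "2 * (b j - b k) = (b i + b j - (b k + b l)) - (b i + b k - (b l + b j))"
    by (simp add: algebra_simps)
  ultimately have "b j = b k" using eq by simp
  then show False using b_eq_iff assms by auto
qed

text \<open>The relation survives every even permutation, so the Klein four identity forces
  \<open>c i + c j = c k + c l\<close> for any four distinct indices. Exchanging \<open>j\<close>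
  and \<open>k\<close> and subtracting gives \<open>c j = c k\<close>.\<close>

lemma conj_sum_eq_0_imp_const:
  assumes "conj_sum c id = 0" "j \<in> {1..n}" "k \<in> {1..n}"
  shows "c j = c k"
proof (cases "j = k")
  case False
  have zero: "conj_sum c \<sigma> = 0" if \<sigma>: "\<sigma> \<in> Alt" for \<sigma>
  proof -
    obtain \<phi> where \<phi>: "field_embedding K \<phi>" "\<And>m. m \<in> {1..n} \<Longrightarrow> \<phi> (b m) = b (\<sigma> m)"
      using perm_embedding[OF \<sigma>] by blast
    then have "\<phi> (conj_sum c id) = conj_sum c \<sigma>" using hom_conj_sum[OF \<phi> id_in_Alt] by simp
    then show ?thesis using assms(1) field_embedding.hom_zero[OF \<phi>(1)] by simp
  qed
  have rel: "c i + c j = c k + c l"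
    if "{i, j, k, l} \<subseteq> {1..n}" "distinct [i, j, k, l]" for i j k l
  proof -
    have "of_int (c i + c j - c k - c l) * (b i + b j - b k - b l) = 0"
      using conj_sum_klein_four[OF that, of c id]
      by (simp add: zero[OF id_in_Alt] klein_four_in_Alt[OF that, THEN zero])
    moreover have "b i + b j - b k - b l \<noteq> 0"
      using b_sums_distinct[OF that] by (simp add: algebra_simps)
    ultimately have "c i + c j - c k - c l = 0" by (metis mult_eq_0_iff of_int_eq_0_iff)
    then show ?thesis by simp
  qed
  obtain i l where il: "{i, j, k, l} \<subseteq> {1..n}" "distinct [i, j, k, l]"
    using obtain_two_more[OF _ assms(2,3) False] n_ge by auto
  then have "c i + c j = c k + c l" "c i + c k = c j + c l"
    using rel[of i j k l] rel[of i k j l] by auto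
  then show ?thesis by simp
qed simp

text \<open>Equality of the two sums is a linear relation with coefficients
  \<open>a (inv' \<sigma> i) - a i\<close>. These are constant in \<open>i\<close>, and the constant
  must be zero.\<close>

lemma conj_sum_eq_iff:
  assumes "\<sigma> \<in> Alt"
  shows "conj_sum a \<sigma> = conj_sum a id \<longleftrightarrow> (\<forall>i\<in>{1..n}. a (\<sigma> i) = a i)"
proof
  have p: "\<sigma> permutes {1..n}" using assms by (simp add: alt_group_carrier)
  {
    assume "\<forall>i\<in>{1..n}. a (\<sigma> i) = a i"
    then have "conj_sum a \<sigma> = (\<Sum>i=1..n. of_int (a (\<sigma> i)) * b (\<sigma> i))"
      unfolding conj_sum_def by (intro sum.cong) auto
    also have "\<dots> = conj_sum a id"
      unfolding conj_sum_def using sum.permute[OF p, of "\<lambda>i. of_int (a i) * b i"] by (simp add: o_def)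
    finally show "conj_sum a \<sigma> = conj_sum a id" .
  }
  assume eq: "conj_sum a \<sigma> = conj_sum a id"
  define c where "c i = a (inv' \<sigma> i) - a i" for i
  have "conj_sum a \<sigma> = (\<Sum>i=1..n. of_int (a (inv' \<sigma> i)) * b i)"
    unfolding conj_sum_def
    using sum.permute[OF p, of "\<lambda>i. of_int (a (inv' \<sigma> i)) * b i"] permutes_inverses(2)[OF p]
    by (simp add: o_def)
  then have "conj_sum c id = 0"
    using eq by (simp add: conj_sum_def c_def left_diff_distrib sum_subtractf)
  then have const: "c i = c 1" if "i \<in> {1..n}" for i
    using conj_sum_eq_0_imp_const[of c i 1] that n_ge by simp
  \<comment> \<open>Permuting \<open>a\<close> does not change its sum, so the coefficients
    \<open>c i\<close> add up to zero, and \<open>n\<close> times their common value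
    vanishes.\<close>
  have "(\<Sum>i=1..n. a (inv' \<sigma> i)) = (\<Sum>i=1..n. a i)"
    using sum.permute[OF permutes_inv[OF p], of a] by (simp add: o_def)
  then have "(\<Sum>i=1..n. c i) = 0" by (simp add: c_def sum_subtractf)
  moreover have "(\<Sum>i=1..n. c i) = (\<Sum>i=1..n. c 1)" by (intro sum.cong refl const)
  ultimately have "c 1 = 0" using n_ge by simp
  show "\<forall>i\<in>{1..n}. a (\<sigma> i) = a i"
  proof
    fix i assume "i \<in> {1..n}"
    then have "c (\<sigma> i) = 0" using const[of "\<sigma> i"] \<open>c 1 = 0\<close> Alt_in[OF assms] by simp
    then show "a (\<sigma> i) = a i" by (simp add: c_def permutes_inverses(2)[OF p])
  qed
qed

section \<open>Generators and stabilizers\<close>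

lemma generator_iff_stabilizer_trivial:
  "rat_adjoin {conj_sum a id} = K \<longleftrightarrow> (\<forall>\<sigma>\<in>Alt. conj_sum a \<sigma> = conj_sum a id \<longrightarrow> \<sigma> = id)"
    (is "?F = K \<longleftrightarrow> _")
proof (intro iffI ballI impI)
  fix \<sigma> assume F: "?F = K" and \<sigma>: "\<sigma> \<in> Alt" "conj_sum a \<sigma> = conj_sum a id"
  obtain \<phi> where \<phi>: "field_embedding K \<phi>" "\<And>m. m \<in> {1..n} \<Longrightarrow> \<phi> (b m) = b (\<sigma> m)"
    using perm_embedding[OF \<sigma>(1)] by blast
  interpret field_embedding K \<phi> by fact
  have "\<phi> (conj_sum a id) = conj_sum a id"
    using hom_conj_sum[OF \<phi> id_in_Alt] \<sigma>(2) by simp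
  \<comment> \<open>The fixed points form a subfield containing \<alpha>. They therefore contain all
    of \<open>K\<close>, and no \<open>b i\<close> moves.\<close>
  then have "?F \<subseteq> {u \<in> K. \<phi> u = u}"
    using conj_sum_in_K[OF id_in_Alt] by (intro rat_adjoin_minimal csubfield_fixed) auto
  then have "K \<subseteq> {u. \<phi> u = u}" unfolding F by blast
  then have "b (\<sigma> i) = b i" if "i \<in> {1..n}" for i
    using b_in_K[OF that] \<phi>(2)[OF that] by auto
  then have "\<sigma> i = i" if "i \<in> {1..n}" for i using that b_eq_iff Alt_in[OF \<sigma>(1)] by blast
  moreover have "\<sigma> permutes {1..n}" using \<sigma>(1) by (simp only: alt_group_carrier)
  ultimately have "\<sigma> i = i" for i by (cases "i \<in> {1..n}") (blast dest: permutes_not_in)+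
  then show "\<sigma> = id" by (simp only: fun_eq_iff id_apply) blast
next
  assume triv: "\<forall>\<sigma>\<in>Alt. conj_sum a \<sigma> = conj_sum a id \<longrightarrow> \<sigma> = id"
  have "b i \<in> ?F" if i: "i \<in> {1..n}" for i
  \<comment> \<open>A missing \<open>b i\<close> would be moved by an embedding over
    \<open>?F\<close>. That embedding fixes \<alpha>, so its permutation is trivial, a
    contradiction.\<close>
  proof (rule ccontr)
    assume notin: "b i \<notin> ?F"
    have alg: "algebraic (b i)" using algebraic_int_b[OF i] by blast
    show False
    proof (rule perm_embedding_moving[OF csubfield_rat_adjoin b_in_K[OF i] alg notin])
      fix \<sigma> \<phi>
      assume s: "\<sigma> \<in> Alt" "field_embedding K \<phi>" "\<And>i. i \<in> {1..n} \<Longrightarrow> \<phi> (b i) = b (\<sigma> i)"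
        "\<And>u. u \<in> ?F \<Longrightarrow> \<phi> u = u" "\<phi> (b i) \<noteq> b i"
      have "\<phi> (conj_sum a id) = conj_sum a id"
        by (rule s(4), rule subsetD[OF subset_rat_adjoin]) simp
      then have "\<sigma> = id" using triv s(1) hom_conj_sum[OF s(2,3) id_in_Alt] by simp
      then show False using s(3)[OF i] s(5) by simp
    qed
  qed
  moreover have "conj_sum a id \<in> K" by (rule conj_sum_in_K[OF id_in_Alt])
  ultimately have "b ` {1..n} \<subseteq> ?F" "{conj_sum a id} \<subseteq> K" by blast+
  then show "?F = K" by (simp only: set_eq_subset rat_adjoin_mono_iff)
qed

text \<open>Two different equal pairs give a nontrivial even permutation preserving
  \<open>a\<close>: a 3-cycle if they share an index, a double transposition if they are disjoint.
  With a single equal pair only a transposition is left, and it is odd.\<close>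

lemma stabilizer_trivial_iff:
  fixes a :: "nat \<Rightarrow> int"
  shows "(\<forall>\<sigma>\<in>Alt. (\<forall>i\<in>{1..n}. a (\<sigma> i) = a i) \<longrightarrow> \<sigma> = id) \<longleftrightarrow>
    card {(i, j). i \<in> {1..n} \<and> j \<in> {1..n} \<and> i < j \<and> a i = a j} \<le> 1"
    (is "?triv \<longleftrightarrow> card ?P \<le> 1")
proof -
  have fin: "finite ?P"
    by (rule finite_subset[of _ "{1..n} \<times> {1..n}"]) auto
  have unique: "card ?P \<le> 1 \<longleftrightarrow> (\<forall>p\<in>?P. \<forall>q\<in>?P. p = q)"
    using card_le_Suc0_iff_eq[OF fin] unfolding One_nat_def .
  show ?thesis
  proof
    assume triv: ?triv
    have inv_transpose: "a (transpose x y m) = a m" if "a x = a y" for x y m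
      using that by (simp add: transpose_def)
    have three: False
      if "{i, j, k} \<subseteq> {1..n}" "distinct [i, j, k]" "a i = a j" "a j = a k" for i j k
    proof -
      have "transpose i j \<circ> transpose j k \<in> Alt"
        by (rule double_transposition_in_alt_group) (use that in \<open>auto simp del: atLeastAtMost_iff\<close>)
      moreover have "\<forall>m\<in>{1..n}. a ((transpose i j \<circ> transpose j k) m) = a m"
        using that by (simp add: inv_transpose)
      ultimately have "transpose i j \<circ> transpose j k = id" using triv by blast
      then have "(transpose i j \<circ> transpose j k) i = i" by simp
      then show False using that by simp
    qed
    have four: False
      if "{i, j, k, l} \<subseteq> {1..n}" "distinct [i, j, k, l]" "a i = a j" "a k = a l" for i j k l
    proof -
      have "transpose i j \<circ> transpose k l \<in> Alt"
        by (rule double_transposition_in_alt_group) (use that in \<open>auto simp del: atLeastAtMost_iff\<close>)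
      moreover have "\<forall>m\<in>{1..n}. a ((transpose i j \<circ> transpose k l) m) = a m"
        using that by (simp add: inv_transpose)
      ultimately have "transpose i j \<circ> transpose k l = id" using triv by blast
      then have "(transpose i j \<circ> transpose k l) i = i" by simp
      then show False using that by simp
    qed
    have "(i, j) = (k, l)" if "(i, j) \<in> ?P" "(k, l) \<in> ?P" for i j k l
    proof (rule ccontr)
      assume ne: "(i, j) \<noteq> (k, l)"
      have I: "i \<in> {1..n}" "j \<in> {1..n}" "k \<in> {1..n}" "l \<in> {1..n}" and "i < j" "k < l"
        and eq: "a i = a j" "a k = a l"
        using that by simp_all
      have lt: "i \<noteq> j" "k \<noteq> l" using \<open>i < j\<close> \<open>k < l\<close> by simp_all
      consider "i = k" "j \<noteq> l" | "i = l" | "j = k" | "j = l" "i \<noteq> k"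
        | "i \<noteq> k" "i \<noteq> l" "j \<noteq> k" "j \<noteq> l"
        using ne by blast
      then show False
      proof cases
        case 1
        then show ?thesis using three[of i j l] I lt eq by simp
      next
        case 2
        then have "k \<noteq> j" using \<open>i < j\<close> \<open>k < l\<close> by simp
        then show ?thesis using 2 three[of k i j] I lt eq by simp
      next
        case 3
        then have "i \<noteq> l" using \<open>i < j\<close> \<open>k < l\<close> by simp
        then show ?thesis using 3 three[of i j l] I lt eq by simp
      next
        case 4
        then show ?thesis using three[of i j k] I lt eq by simp
      next
        case 5
        have "{i, j, k, l} \<subseteq> {1..n}" "distinct [i, j, k, l]" using I 5 lt by (blast, simp)
        then show ?thesis using four[of i j k l] eq by blast
      qed
    qed
    then have "p = q" if "p \<in> ?P" "q \<in> ?P" for p q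
      using that by (cases p, cases q) blast
    then show "card ?P \<le> 1" unfolding unique by blast
  next
    assume "card ?P \<le> 1"
    show ?triv
    proof (intro ballI impI, rule ccontr)
      fix \<sigma> assume \<sigma>: "\<sigma> \<in> Alt" "\<forall>i\<in>{1..n}. a (\<sigma> i) = a i" "\<sigma> \<noteq> id"
      have p: "\<sigma> permutes {1..n}" using \<sigma>(1) by (simp add: alt_group_carrier)
      obtain m where m: "\<sigma> m \<noteq> m" using \<sigma>(3) unfolding fun_eq_iff id_apply by blast
      then have mI: "m \<in> {1..n}" using p by (blast dest: permutes_not_in)
      \<comment> \<open>Each moved index forms an equal pair with its image, sorted by
        \<open>min\<close> and \<open>max\<close> to match \<open>?P\<close>. There is only one such
        pair, so \<open>\<sigma>\<close> is the transposition of \<open>m\<close> and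
        \<open>\<sigma> m\<close>.\<close>
      have pair: "{x, \<sigma> x} = {m, \<sigma> m}" if x: "\<sigma> x \<noteq> x" for x
      proof -
        have xI: "x \<in> {1..n}" using x p by (blast dest: permutes_not_in)
        have P: "(min y (\<sigma> y), max y (\<sigma> y)) \<in> ?P" if "y \<in> {1..n}" "\<sigma> y \<noteq> y" for y
          using that \<sigma>(2) Alt_in[OF \<sigma>(1) that(1)] by (auto simp: min_def max_def)
        have "(min x (\<sigma> x), max x (\<sigma> x)) = (min m (\<sigma> m), max m (\<sigma> m))"
          using P[OF xI x] P[OF mI m] \<open>card ?P \<le> 1\<close> unfolding unique by blast
        then show ?thesis by (auto simp: min_def max_def split: if_splits)
      qed
      have "\<sigma> (\<sigma> m) = m"
      proof -
        have "\<sigma> (\<sigma> m) \<noteq> \<sigma> m" using m permutes_inj[OF p] by (auto dest: injD)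
        then show ?thesis using pair[of "\<sigma> m"] by auto
      qed
      then have "\<sigma> = transpose m (\<sigma> m)"
        using pair by (auto simp: fun_eq_iff transpose_def)
      from arg_cong[OF this, of evenperm] have "\<not> evenperm \<sigma>"
        using m by (simp add: evenperm_swap)
      then show False using \<sigma>(1) by (simp add: alt_group_carrier)
    qed
  qed
qed

section \<open>Norms, and bounds for products and degrees of conjugates\<close>

lemma fixed_algebraic_int:
  assumes "x \<in> K" "algebraic_int x"
    and "\<And>\<tau> \<phi>. \<tau> \<in> Alt \<Longrightarrow> field_embedding K \<phi> \<Longrightarrow> (\<And>i. i \<in> {1..n} \<Longrightarrow> \<phi> (b i) = b (\<tau> i)) \<Longrightarrow> \<phi> x = x"
  shows "x \<in> \<int>"
\<comment> \<open>Galois invariance puts \<open>x\<close> into \<rat>, where algebraic integers are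
  integers.\<close>
proof (rule rational_algebraic_int_is_int[OF assms(2)])
  show "x \<in> \<rat>"
  proof (rule ccontr)
    assume notin: "x \<notin> \<rat>"
    have alg: "algebraic x" using assms(2) by blast
    show False
      by (rule perm_embedding_moving[OF csubfield_Rats assms(1) alg notin]) (use assms(3) in blast)
  qed
qed

text \<open>The third assumption says that automorphisms act on the factors by left translation, so
  they only permute the product.\<close>

lemma norm_in_Ints:
  assumes "\<And>\<sigma>. \<sigma> \<in> Alt \<Longrightarrow> f \<sigma> \<in> K" "\<And>\<sigma>. \<sigma> \<in> Alt \<Longrightarrow> algebraic_int (f \<sigma>)"
    and "\<And>\<sigma> \<tau> \<phi>. \<sigma> \<in> Alt \<Longrightarrow> \<tau> \<in> Alt \<Longrightarrow> field_embedding K \<phi> \<Longrightarrow>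
      (\<And>i. i \<in> {1..n} \<Longrightarrow> \<phi> (b i) = b (\<tau> i)) \<Longrightarrow> \<phi> (f \<sigma>) = f (\<tau> \<circ> \<sigma>)"
  shows "(\<Prod>\<sigma>\<in>Alt. f \<sigma>) \<in> \<int>"
proof (rule fixed_algebraic_int)
  show "(\<Prod>\<sigma>\<in>Alt. f \<sigma>) \<in> K" using assms(1) by (rule K.prod_closed)
  show "algebraic_int (\<Prod>\<sigma>\<in>Alt. f \<sigma>)" using assms(2) by (rule algebraic_int_prod)
  fix \<tau> \<phi> assume \<tau>: "\<tau> \<in> Alt" "field_embedding K \<phi>" "\<And>i. i \<in> {1..n} \<Longrightarrow> \<phi> (b i) = b (\<tau> i)"
  interpret field_embedding K \<phi> by fact
  have "\<phi> (\<Prod>\<sigma>\<in>Alt. f \<sigma>) = (\<Prod>\<sigma>\<in>Alt. f (\<tau> \<circ> \<sigma>))"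
    using assms(1,3) \<tau> by (simp add: hom_prod)
  also have "\<dots> = (\<Prod>\<sigma>\<in>Alt. f \<sigma>)"
    by (rule prod.reindex_bij_betw[OF bij_betw_Alt_left[OF \<tau>(1)]])
  finally show "\<phi> (\<Prod>\<sigma>\<in>Alt. f \<sigma>) = (\<Prod>\<sigma>\<in>Alt. f \<sigma>)" .
qed

lemma prod_conj_sum_bound:
  assumes "{i, j, k, l} \<subseteq> {1..n}" "distinct [i, j, k, l]"
  shows "\<bar>real_of_int (a i + a j - a k - a l)\<bar> ^ card Alt
    \<le> 4 ^ card Alt * (\<Prod>\<sigma>\<in>Alt. max 1 (cmod (conj_sum a \<sigma>))) ^ 4"
proof -
  let ?A = "real_of_int (a i + a j - a k - a l)"
  let ?m = "\<lambda>\<sigma>. max 1 (cmod (conj_sum a \<sigma>))"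
  define \<delta> where "\<delta> \<sigma> = b (\<sigma> i) + b (\<sigma> j) - b (\<sigma> k) - b (\<sigma> l)" for \<sigma>
  define u v w where "u = transpose i j \<circ> transpose k l" and "v = transpose i k \<circ> transpose j l"
    and "w = transpose i l \<circ> transpose j k"
  have uvw: "u \<in> Alt" "v \<in> Alt" "w \<in> Alt"
    unfolding u_def v_def w_def by (rule klein_four_in_Alt[OF assms])+
  have I: "i \<in> {1..n}" "j \<in> {1..n}" "k \<in> {1..n}" "l \<in> {1..n}" using assms(1) by blast+
  have \<delta>_int: "(\<Prod>\<sigma>\<in>Alt. \<delta> \<sigma>) \<in> \<int>"
  proof (rule norm_in_Ints)
    fix \<sigma> assume \<sigma>: "\<sigma> \<in> Alt"
    note mem = Alt_in[OF \<sigma> I(1)] Alt_in[OF \<sigma> I(2)] Alt_in[OF \<sigma> I(3)] Alt_in[OF \<sigma> I(4)]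
    show "\<delta> \<sigma> \<in> K" unfolding \<delta>_def by (intro K.add_closed K.diff_closed b_in_K mem)
    show "algebraic_int (\<delta> \<sigma>)"
      unfolding \<delta>_def diff_conv_add_uminus
      by (intro algebraic_int_add algebraic_int_minus algebraic_int_b mem)
    fix \<tau> \<phi> assume \<tau>: "\<tau> \<in> Alt" "field_embedding K \<phi>" "\<And>i. i \<in> {1..n} \<Longrightarrow> \<phi> (b i) = b (\<tau> i)"
    interpret field_embedding K \<phi> by fact
    show "\<phi> (\<delta> \<sigma>) = \<delta> (\<tau> \<circ> \<sigma>)"
      using mem b_in_K[OF mem(1)] b_in_K[OF mem(2)] b_in_K[OF mem(3)] b_in_K[OF mem(4)]
      by (simp add: \<delta>_def hom_add hom_diff K.add_closed K.diff_closed \<tau>(3) del: atLeastAtMost_iff)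
  qed
  have "\<delta> \<sigma> \<noteq> 0" if \<sigma>: "\<sigma> \<in> Alt" for \<sigma>
  proof -
    have "inj \<sigma>" using \<sigma> by (auto simp: alt_group_carrier dest: permutes_inj)
    then have "distinct [\<sigma> i, \<sigma> j, \<sigma> k, \<sigma> l]" using assms(2) by (auto dest: injD)
    then have "b (\<sigma> i) + b (\<sigma> j) \<noteq> b (\<sigma> k) + b (\<sigma> l)"
      using Alt_in[OF \<sigma>] I by (intro b_sums_distinct) auto
    then show ?thesis by (simp add: \<delta>_def algebra_simps)
  qed
  then have "(\<Prod>\<sigma>\<in>Alt. \<delta> \<sigma>) \<noteq> 0" using finite_Alt by simp
  then have \<delta>_ge: "cmod (\<Prod>\<sigma>\<in>Alt. \<delta> \<sigma>) \<ge> 1"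
    using \<delta>_int by (auto elim!: Ints_cases simp: norm_of_int simp flip: of_int_abs)
  have point: "\<bar>?A\<bar> * cmod (\<delta> \<sigma>) \<le> 4 * (?m \<sigma> * ?m (\<sigma> \<circ> u) * ?m (\<sigma> \<circ> v) * ?m (\<sigma> \<circ> w))" for \<sigma>
  proof -
    have eq: "of_int (a i + a j - a k - a l) * \<delta> \<sigma> =
      conj_sum a \<sigma> + conj_sum a (\<sigma> \<circ> u) - conj_sum a (\<sigma> \<circ> v) - conj_sum a (\<sigma> \<circ> w)"
      using conj_sum_klein_four[OF assms, of a \<sigma>] by (simp add: \<delta>_def u_def v_def w_def)
    have "\<bar>?A\<bar> * cmod (\<delta> \<sigma>) = cmod (of_int (a i + a j - a k - a l) * \<delta> \<sigma>)"
      by (simp only: norm_mult norm_of_int)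
    also have "\<dots> \<le> cmod (conj_sum a \<sigma>) + cmod (conj_sum a (\<sigma> \<circ> u))
        + cmod (conj_sum a (\<sigma> \<circ> v)) + cmod (conj_sum a (\<sigma> \<circ> w))"
      unfolding eq by (intro norm_triangle_le_diff norm_triangle_le add_mono order_refl)
    also have "\<dots> \<le> ?m \<sigma> + ?m (\<sigma> \<circ> u) + ?m (\<sigma> \<circ> v) + ?m (\<sigma> \<circ> w)"
      by (intro add_mono max.cobounded2)
    \<comment> \<open>Four numbers that are at least 1 are each bounded by their product; this turns
      the sum into something multiplicative.\<close>
    also have "\<dots> \<le> 4 * (?m \<sigma> * ?m (\<sigma> \<circ> u) * ?m (\<sigma> \<circ> v) * ?m (\<sigma> \<circ> w))"
    proof -
      have "p + q + r + s \<le> 4 * (p * q * r * s)" if "p \<ge> 1" "q \<ge> 1" "r \<ge> 1" "s \<ge> 1" for p q r s :: real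
      proof -
        have "1 \<le> p * q" "1 \<le> r * s" using that mult_mono[of 1 p 1 q] mult_mono[of 1 r 1 s] by auto
        moreover have "p \<le> p * q" "q \<le> p * q" "r \<le> r * s" "s \<le> r * s"
          using that by (auto simp: mult_le_cancel_left1 mult_le_cancel_right1)
        moreover have "p * q \<le> p * q * (r * s)" "r * s \<le> p * q * (r * s)"
          using calculation(1,2) by (auto simp: mult_le_cancel_left1 mult_le_cancel_right1)
        ultimately show ?thesis by (simp add: mult.assoc)
      qed
      then show ?thesis by simp
    qed
    finally show ?thesis .
  qed
  have reindex: "(\<Prod>\<sigma>\<in>Alt. ?m (\<sigma> \<circ> \<tau>)) = (\<Prod>\<sigma>\<in>Alt. ?m \<sigma>)" if "\<tau> \<in> Alt" for \<tau>
    by (rule prod.reindex_bij_betw[OF bij_betw_Alt_right[OF that]])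
  have "\<bar>?A\<bar> ^ card Alt \<le> \<bar>?A\<bar> ^ card Alt * cmod (\<Prod>\<sigma>\<in>Alt. \<delta> \<sigma>)"
    using mult_left_mono[OF \<delta>_ge, of "\<bar>?A\<bar> ^ card Alt"] by simp
  also have "\<dots> = (\<Prod>\<sigma>\<in>Alt. \<bar>?A\<bar> * cmod (\<delta> \<sigma>))"
    by (simp add: prod.distrib prod_norm)
  also have "\<dots> \<le> (\<Prod>\<sigma>\<in>Alt. 4 * (?m \<sigma> * ?m (\<sigma> \<circ> u) * ?m (\<sigma> \<circ> v) * ?m (\<sigma> \<circ> w)))"
    using point by (intro prod_mono) auto
  also have "\<dots> = 4 ^ card Alt * (\<Prod>\<sigma>\<in>Alt. ?m \<sigma>) ^ 4"
    by (simp only: prod.distrib reindex[OF uvw(1)] reindex[OF uvw(2)] reindex[OF uvw(3)])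
      (simp add: power4_eq_xxxx)
  finally show ?thesis .
qed

text \<open>The product of the linear factors over all of \<open>Alt\<close> is Galois invariant
  with integral coefficients. It is thus an integer polynomial of degree at most
  \<open>card Alt\<close> that vanishes at \<alpha>.\<close>

lemma alg_degree_conj_sum_le: "alg_degree (conj_sum a id) \<le> card Alt"
proof -
  define P where "P = (\<Prod>\<sigma>\<in>Alt. [:- conj_sum a \<sigma>, 1:])"
  have fac: "coeffs_in K [:- conj_sum a \<sigma>, 1:]" if "\<sigma> \<in> Alt" for \<sigma>
    using conj_sum_in_K[OF that]
    by (intro K.coeffs_in_pCons K.coeffs_in_0 K.uminus_closed K.one_closed)
  have P_in: "coeffs_in K P" unfolding P_def by (rule K.coeffs_in_prod) (rule fac)
  have int: "Polynomial.coeff P k \<in> \<int>" for k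
  proof (rule fixed_algebraic_int)
    show "Polynomial.coeff P k \<in> K" using P_in by (simp add: coeffs_in_def)
    show "algebraic_int (Polynomial.coeff P k)"
      unfolding P_def by (intro algebraic_int_coeff_prod_linear algebraic_int_conj_sum)
    fix \<tau> \<phi> assume \<tau>: "\<tau> \<in> Alt" "field_embedding K \<phi>" "\<And>i. i \<in> {1..n} \<Longrightarrow> \<phi> (b i) = b (\<tau> i)"
    interpret field_embedding K \<phi> by fact
    have "map_poly \<phi> P = (\<Prod>\<sigma>\<in>Alt. map_poly \<phi> [:- conj_sum a \<sigma>, 1:])"
      unfolding P_def by (rule map_poly_hom_prod) (rule fac)
    also have "\<dots> = (\<Prod>\<sigma>\<in>Alt. [:- conj_sum a (\<tau> \<circ> \<sigma>), 1:])"
      using conj_sum_in_K hom_conj_sum[OF \<tau>(2,3)]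
      by (intro prod.cong refl) (simp add: map_poly_pCons hom_zero hom_one hom_uminus)
    also have "\<dots> = P"
      unfolding P_def by (rule prod.reindex_bij_betw[OF bij_betw_Alt_left[OF \<tau>(1)]])
    finally have "map_poly \<phi> P = P" .
    then show "\<phi> (Polynomial.coeff P k) = Polynomial.coeff P k"
      by (metis coeff_map_poly hom_zero)
  qed
  \<comment> \<open>The coefficients are integers viewed as complex numbers, and
    \<open>\<lfloor>Re z\<rfloor>\<close> recovers them.\<close>
  define p :: "int poly" where "p = map_poly (\<lambda>z. \<lfloor>Re z\<rfloor>) P"
  have pP: "map_poly of_int p = P"
  proof (rule poly_eqI)
    fix k
    obtain z :: int where "Polynomial.coeff P k = of_int z" using int[of k] by (auto elim: Ints_cases)
    then show "Polynomial.coeff (map_poly of_int p) k = Polynomial.coeff P k"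
      by (simp add: p_def coeff_map_poly)
  qed
  have "P \<noteq> 0" unfolding P_def using finite_Alt by simp
  then have "p \<noteq> 0" using pP by auto
  moreover have "poly (map_poly of_int p) (conj_sum a id) = 0"
    unfolding pP P_def poly_prod using finite_Alt id_in_Alt by (intro prod_zero) auto
  ultimately have "Polynomial.degree (min_int_poly (conj_sum a id)) \<le> Polynomial.degree p"
    by (intro dvd_imp_degree_le min_int_poly_dvd)
  also have "\<dots> \<le> Polynomial.degree P"
    unfolding p_def by (rule degree_le) (simp add: coeff_map_poly coeff_eq_0)
  also have "\<dots> \<le> (\<Sum>\<sigma>\<in>Alt. Polynomial.degree [:- conj_sum a \<sigma>, 1:])"
    unfolding P_def using degree_prod_sum_le[OF finite_Alt, of "\<lambda>\<sigma>. [:- conj_sum a \<sigma>, 1:]"] by (simp add: o_def)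
  also have "\<dots> = card Alt" by simp
  finally show ?thesis by (simp add: alg_degree_def)
qed

lemma conj_sum_in_conjugates:
  assumes "\<sigma> \<in> Alt"
  shows "conj_sum a \<sigma> \<in> conjugates (conj_sum a id)"
proof -
  have "algebraic (conj_sum a id)" using algebraic_int_conj_sum[OF id_in_Alt] by blast
  then have root: "poly (map_poly of_int (min_int_poly (conj_sum a id))) (conj_sum a id) = 0"
    using is_min_int_poly_min_int_poly by (simp add: is_min_int_poly_def)
  obtain \<phi> where \<phi>: "field_embedding K \<phi>" "\<And>m. m \<in> {1..n} \<Longrightarrow> \<phi> (b m) = b (\<sigma> m)"
    using perm_embedding[OF assms] by blast
  have "\<phi> (conj_sum a id) = conj_sum a \<sigma>" using hom_conj_sum[OF \<phi> id_in_Alt] by simp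
  then show ?thesis
    using field_embedding.hom_root_int_poly[OF \<phi>(1) root conj_sum_in_K[OF id_in_Alt]]
    by (simp add: conjugates_def)
qed

text \<open>Applying the automorphism of \<open>inv' \<tau>\<close> reduces equality of two
  conjugates to equality with \<open>conj_sum a id\<close>.\<close>

lemma inj_on_conj_sum:
  assumes "\<forall>\<sigma>\<in>Alt. conj_sum a \<sigma> = conj_sum a id \<longrightarrow> \<sigma> = id"
  shows "inj_on (conj_sum a) Alt"
proof (rule inj_onI)
  fix \<sigma> \<tau> assume st: "\<sigma> \<in> Alt" "\<tau> \<in> Alt" "conj_sum a \<sigma> = conj_sum a \<tau>"
  have p: "\<tau> permutes {1..n}" using st(2) by (simp only: alt_group_carrier)
  have inv: "inv' \<tau> \<in> Alt" by (rule alt_group_inv_closed[OF st(2)])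
  obtain \<phi> where \<phi>: "field_embedding K \<phi>" "\<And>m. m \<in> {1..n} \<Longrightarrow> \<phi> (b m) = b (inv' \<tau> m)"
    using perm_embedding[OF inv] by blast
  have "conj_sum a (inv' \<tau> \<circ> \<sigma>) = conj_sum a (inv' \<tau> \<circ> \<tau>)"
    using hom_conj_sum[OF \<phi> st(1)] hom_conj_sum[OF \<phi> st(2)] st(3) by metis
  then have "inv' \<tau> \<circ> \<sigma> = id"
    using assms Alt_comp[OF inv st(1)] permutes_inv_o(2)[OF p] by simp
  then have "\<tau> \<circ> (inv' \<tau> \<circ> \<sigma>) = \<tau>" by simp
  then show "\<sigma> = \<tau>" by (simp only: comp_assoc[symmetric] permutes_inv_o(1)[OF p] id_o)
qed

section \<open>Mahler measure and height of a generator\<close>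

lemma finite_conjugates_conj_sum: "finite (conjugates (conj_sum a id))"
  and lead_coeff_conj_sum: "Polynomial.lead_coeff (min_int_poly (conj_sum a id)) \<ge> 1"
  and alg_degree_conj_sum_pos: "alg_degree (conj_sum a id) > 0"
proof -
  have "algebraic (conj_sum a id)" using algebraic_int_conj_sum[OF id_in_Alt] by blast
  then have min: "is_min_int_poly (conj_sum a id) (min_int_poly (conj_sum a id))"
    by (rule is_min_int_poly_min_int_poly)
  then show "Polynomial.lead_coeff (min_int_poly (conj_sum a id)) \<ge> 1"
    by (simp add: is_min_int_poly_def)
  have nz: "min_int_poly (conj_sum a id) \<noteq> 0" using min by (auto simp: is_min_int_poly_def)
  then show "alg_degree (conj_sum a id) > 0"
    unfolding alg_degree_def using min by (intro degree_pos_of_root) (auto simp: is_min_int_poly_def)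
  have "map_poly of_int (min_int_poly (conj_sum a id)) \<noteq> (0 :: complex poly)"
    using nz by (auto simp: poly_eq_iff coeff_map_poly)
  then show "finite (conjugates (conj_sum a id))"
    unfolding conjugates_def by (rule poly_roots_finite)
qed

text \<open>The leading coefficient and all factors are at least 1, so any of them may be dropped;
  \<open>S = {}\<close> gives nonnegativity of the height.\<close>

lemma mahler_ge:
  assumes "S \<subseteq> conjugates (conj_sum a id)"
  shows "mahler (conj_sum a id) \<ge> (\<Prod>z\<in>S. max 1 (cmod z))"
proof -
  let ?C = "conjugates (conj_sum a id)"
  have "(\<Prod>z\<in>S. max 1 (cmod z)) \<le> (\<Prod>z\<in>?C. max 1 (cmod z))"
    using assms finite_conjugates_conj_sum by (intro prod_mono2) auto
  also have "\<dots> = 1 * (\<Prod>z\<in>?C. max 1 (cmod z))" by simp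
  also have "\<dots> \<le> mahler (conj_sum a id)"
    unfolding mahler_def using lead_coeff_conj_sum[of a]
    by (intro mult_right_mono prod_nonneg) auto
  finally show ?thesis .
qed

lemma weil_height_nonneg: "weil_height (conj_sum a id) \<ge> 0"
  using mahler_ge[of "{}" a] by (simp add: weil_height_def)

text \<open>For a generator the conjugates indexed by \<open>Alt\<close> are distinct, so the
  product over the group is part of the Mahler measure. Logarithms of
  \<open>prod_conj_sum_bound\<close> then give the claim.\<close>

lemma weil_height_ge:
  assumes gen: "rat_adjoin {conj_sum a id} = K"
    and ix: "{i, j, k, l} \<subseteq> {1..n}" "distinct [i, j, k, l]"
    and A: "a i + a j - a k - a l \<ge> 4"
  shows "weil_height (conj_sum a id) \<ge> 1 / 4 * ln (real_of_int (a i + a j - a k - a l) / 4)"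
proof -
  let ?A = "real_of_int (a i + a j - a k - a l)"
  let ?M = "\<Prod>\<sigma>\<in>Alt. max 1 (cmod (conj_sum a \<sigma>))"
  let ?N = "card Alt" and ?d = "alg_degree (conj_sum a id)" and ?m = "mahler (conj_sum a id)"
  have A4: "?A \<ge> 4" using A by linarith
  have inj: "inj_on (conj_sum a) Alt"
    using gen generator_iff_stabilizer_trivial inj_on_conj_sum by blast
  have "?M = (\<Prod>z\<in>conj_sum a ` Alt. max 1 (cmod z))"
    by (simp add: prod.reindex[OF inj])
  also have "\<dots> \<le> ?m" by (rule mahler_ge) (use conj_sum_in_conjugates in blast)
  finally have M_le: "?M \<le> ?m" .
  have M_ge: "?M \<ge> 1" by (rule prod_ge_1) simp
  have "?A ^ ?N \<le> 4 ^ ?N * ?M ^ 4" using prod_conj_sum_bound[OF ix, of a] A4 by simp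
  then have "(?A / 4) ^ ?N \<le> ?M ^ 4" by (simp add: power_divide field_simps)
  then have "ln ((?A / 4) ^ ?N) \<le> ln (?M ^ 4)" using A4 by (subst ln_le_cancel_iff) (use M_ge in auto)
  then have "real ?N * ln (?A / 4) \<le> 4 * ln ?M" using A4 M_ge by (simp add: ln_realpow)
  also have "\<dots> \<le> 4 * ln ?m" using M_le M_ge by simp
  finally have N: "real ?N * ln (?A / 4) \<le> 4 * ln ?m" .
  \<comment> \<open>Since \<open>?A \<ge> 4\<close> makes the logarithm nonnegative, the group order
    may be replaced by the degree, which is at most as large.\<close>
  have "real ?d * ln (?A / 4) \<le> real ?N * ln (?A / 4)"
    using alg_degree_conj_sum_le[of a] A4 by (intro mult_right_mono) auto
  with N have "real ?d * ln (?A / 4) \<le> 4 * ln ?m" by linarith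
  then show ?thesis
    using alg_degree_conj_sum_pos[of a] by (simp add: weil_height_def field_simps)
qed

text \<open>For \<open>n \<ge> 10\<close> the spread gives
  \<open>1 / 4 * ln ((2 * n - 6) / 4)\<close>, which exceeds the claimed bound. For smaller
  \<open>n\<close> the claimed bound is at most 0.\<close>

lemma weil_height_generator_ge:
  assumes gen: "rat_adjoin {conj_sum a id} = K" and card: "card (a ` {1..n}) \<ge> n - 1"
  shows "weil_height (conj_sum a id) \<ge> 1 / 240 * ln (real n / 9)"
proof (cases "n \<ge> 10")
  case True
  obtain i j k l where ix: "{i, j, k, l} \<subseteq> {1..n}" "distinct [i, j, k, l]"
    and A: "a i + a j - a k - a l \<ge> 2 * int n - 6"
    using exists_spread_quadruple[OF card n_ge] by blast
  let ?A = "real_of_int (a i + a j - a k - a l)"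
  have "x / 9 \<le> y / 4" if "2 * x - 6 \<le> y" "10 \<le> x" for x y :: real using that by argo
  moreover have "2 * real n - 6 \<le> ?A" using A by linarith
  moreover have "10 \<le> real n" using True by simp
  ultimately have "real n / 9 \<le> ?A / 4" by blast
  then have "ln (real n / 9) \<le> ln (?A / 4)" using True by simp
  moreover have "ln (real n / 9) \<ge> 0" using True by simp
  ultimately have "1 / 240 * ln (real n / 9) \<le> 1 / 4 * ln (?A / 4)" by linarith
  also have "\<dots> \<le> weil_height (conj_sum a id)"
    by (rule weil_height_ge[OF gen ix]) (use A True in linarith)
  finally show ?thesis .
next
  case False
  then have "ln (real n / 9) \<le> 0" using n_ge by simp
  then show ?thesis using weil_height_nonneg[of a] by linarith
qed

end

theorem theorem1p5:
  shows "(\<forall>(n :: nat) (\<beta> :: complex) (b :: nat \<Rightarrow> complex) (a :: nat \<Rightarrow> int).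
            n \<ge> 5 \<longrightarrow> alternating_conjugates n \<beta> b \<longrightarrow>
            (let \<alpha> = (\<Sum>i=1..n. of_int (a i) * b i);
                 generator = (rat_adjoin {\<alpha>} = rat_adjoin (b ` {1..n}))
             in (generator \<longleftrightarrow> card {(i, j). i \<in> {1..n} \<and> j \<in> {1..n} \<and> i < j \<and> a i = a j} \<le> 1) \<and>
                (generator \<longleftrightarrow> card (a ` {1..n}) \<ge> n - 1) \<and>
                (generator \<longrightarrow> weil_height \<alpha> \<ge> 1 / 240 * ln (real n / 9)))) \<and>
         (\<forall>C :: real. \<forall>\<^sub>F n in sequentially.
            \<forall>(\<beta> :: complex) (b :: nat \<Rightarrow> complex) (a :: nat \<Rightarrow> int).
            n \<ge> 5 \<longrightarrow> alternating_conjugates n \<beta> b \<longrightarrow>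
            (let \<alpha> = (\<Sum>i=1..n. of_int (a i) * b i)
             in rat_adjoin {\<alpha>} = rat_adjoin (b ` {1..n}) \<longrightarrow> weil_height \<alpha> \<ge> C))"
proof -
  have main: "(rat_adjoin {\<Sum>i=1..n. of_int (a i) * b i} = rat_adjoin (b ` {1..n}) \<longleftrightarrow>
        card {(i, j). i \<in> {1..n} \<and> j \<in> {1..n} \<and> i < j \<and> a i = a j} \<le> 1) \<and>
      (rat_adjoin {\<Sum>i=1..n. of_int (a i) * b i} = rat_adjoin (b ` {1..n}) \<longleftrightarrow>
        card (a ` {1..n}) \<ge> n - 1) \<and>
      (rat_adjoin {\<Sum>i=1..n. of_int (a i) * b i} = rat_adjoin (b ` {1..n}) \<longrightarrow>
        weil_height (\<Sum>i=1..n. of_int (a i) * b i) \<ge> 1 / 240 * ln (real n / 9))"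
    if "n \<ge> 5" "alternating_conjugates n \<beta> b" for n \<beta> b and a :: "nat \<Rightarrow> int"
  proof -
    interpret alternating_field n \<beta> b using that by unfold_locales
    have \<alpha>: "(\<Sum>i=1..n. of_int (a i) * b i) = conj_sum a id" by (simp add: conj_sum_def)
    \<comment> \<open>The stabilizer of \<alpha> in \<open>Alt\<close> is that of the coefficient
      vector, by \<open>conj_sum_eq_iff\<close>.\<close>
    have stab: "rat_adjoin {conj_sum a id} = K \<longleftrightarrow>
      card {(i, j). i \<in> {1..n} \<and> j \<in> {1..n} \<and> i < j \<and> a i = a j} \<le> 1"
      unfolding generator_iff_stabilizer_trivial stabilizer_trivial_iff[symmetric]
      using conj_sum_eq_iff by blast
    show ?thesis
      unfolding \<alpha> using stab stab[unfolded card_equal_pairs_le_1_iff] weil_height_generator_ge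
      by blast
  qed
  have large: "\<forall>\<^sub>F n in sequentially. 1 / 240 * ln (real n / 9) \<ge> C" for C :: real
  proof -
    \<comment> \<open>The lower bound for the height reaches \<open>C\<close> at
      \<open>n = 9 * exp (240 * C)\<close>.\<close>
    have "\<forall>\<^sub>F n in sequentially. real n \<ge> 9 * exp (240 * C)"
      using filterlim_real_sequentially by (auto simp: filterlim_at_top)
    then show ?thesis
    proof eventually_elim
      case (elim n)
      then have "exp (240 * C) \<le> real n / 9" by simp
      moreover from this have "0 < real n / 9" by (rule less_le_trans[OF exp_gt_zero])
      ultimately have "240 * C \<le> ln (real n / 9)" by (simp only: ln_ge_iff)
      then show ?case by simp
    qed
  qed
  \<comment> \<open>The bound depends on \<open>n\<close> alone, so one threshold serves every
    \<open>\<beta>\<close>, \<open>b\<close> and \<open>a\<close>.\<close>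
  have "\<forall>\<^sub>F n in sequentially. \<forall>\<beta> b (a :: nat \<Rightarrow> int). n \<ge> 5 \<longrightarrow> alternating_conjugates n \<beta> b \<longrightarrow>
      rat_adjoin {\<Sum>i=1..n. of_int (a i) * b i} = rat_adjoin (b ` {1..n}) \<longrightarrow>
      weil_height (\<Sum>i=1..n. of_int (a i) * b i) \<ge> C" for C :: real
    using large[of C]
  proof eventually_elim
    case (elim n)
    then show ?case using main order_trans by meson
  qed
  then show ?thesis unfolding Let_def using main by blast
qed

end
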